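(* Let $(X,\mathbf R)$ be a symmetric association scheme with $D\ge3$ classes which is metric with respect to $A_0,\dots,A_D$ and cometric with respect to $E_0,\dots,E_D$, and which is not an ordinary cycle. Let $Y\subseteq X$ with $1<|Y|<|X|$ and set $\delta^*=\delta^*(Y)$. Let $0\le t\le D$ and suppose that $A_\ell\chi_Y$ is a relative $t$-codesign with respect to $x$ for every $0\le\ell\le D$ and every $x\in Y$. Suppose further that for every $x\in Y$, each irreducible $T(x)$-module $W\subseteq V$ with $1\le r^*(W)\le\delta^*$ satisfies $r(W)\le r^*(W)$. Then one of the following holds: (i) $(X,R_1)$ is bipartite and $Y$ is one of its two bipartite halves (colour classes); (ii) $(X,\mathbf R)$ is an antipodal double cover and $Y=\{x,y\}$ is an antipodal pair, i.e. $(x,y)\in R_D$; (iii) $\delta^*\ge t+1$.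
   Context: $(X,\mathbf R)$ is a symmetric association scheme with associate matrices $A_0=I,\dots,A_D$, Bose–Mesner algebra $M$, primitive idempotents $E_0=|X|^{-1}J,\dots,E_D$. Metric: $(X,R_1)$ is distance-regular with $R_i$ its distance-$i$ relation. Cometric: each $E_j$ is a polynomial of degree exactly $j$ in $E_1$ under entrywise multiplication. Antipodal double cover: the relation "$y=z$ or $(y,z)\in R_D$" is an equivalence relation on $X$ whose classes all have size $2$. $V=\mathbb C^X$ with standard basis $\{\hat y\}$ and standard Hermitian inner product; $\chi_Y=\sum_{y\in Y}\hat y$. $\delta^*(Y)=\min\{j\ne0:E_j\chi_Y\ne0\}$. $E_i^*(x)$ is diagonal with $(E_i^*(x))_{yy}=(A_i)_{xy}$; $A_i^*(x)$ diagonal with $(A_i^*(x))_{yy}=|X|(E_i)_{xy}$; $T(x)$ is generated by $M$ and the $A_i^*(x)$. For an irreducible $T(x)$-module $W$: $r(W)=\min\{i:E_i^*(x)W\ne0\}$, $r^*(W)=\min\{j:E_jW\ne0\}$. $\psi$ is a relative $t$-codesign with respect to $x$ if $E_i^*(x)\psi$ and $A_i\hat x$ are linearly dependent for all $1\le i\le t$. *)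

theory Defs
  imports Complex_Main "HOL-Computational_Algebra.Polynomial"
begin

text \<open>Matrices and vectors indexed by the finite vertex type 'a (X = UNIV), over the complex numbers.\<close>

type_synonym 'a cmat = "'a \<Rightarrow> 'a \<Rightarrow> complex"
type_synonym 'a cvec = "'a \<Rightarrow> complex"

definition zero_vec :: "'a cvec" where
  "zero_vec = (\<lambda>_. 0)"

definition zero_mat :: "'a cmat" where
  "zero_mat = (\<lambda>_ _. 0)"

definition mmult :: "('a::finite) cmat \<Rightarrow> 'a cmat \<Rightarrow> 'a cmat" where
  "mmult P Q = (\<lambda>x y. \<Sum>z\<in>UNIV. P x z * Q z y)"

definition madd :: "'a cmat \<Rightarrow> 'a cmat \<Rightarrow> 'a cmat" where
  "madd P Q = (\<lambda>x y. P x y + Q x y)"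

definition msmult :: "complex \<Rightarrow> 'a cmat \<Rightarrow> 'a cmat" where
  "msmult c P = (\<lambda>x y. c * P x y)"

definition mvec :: "('a::finite) cmat \<Rightarrow> 'a cvec \<Rightarrow> 'a cvec" where
  "mvec P v = (\<lambda>x. \<Sum>z\<in>UNIV. P x z * v z)"

definition diagm :: "'a cvec \<Rightarrow> 'a cmat" where
  "diagm d = (\<lambda>x y. if x = y then d x else 0)"

definition adjm :: "('a \<times> 'a) set \<Rightarrow> 'a cmat" where
  "adjm S = (\<lambda>x y. if (x, y) \<in> S then 1 else 0)"

definition basisv :: "'a \<Rightarrow> 'a cvec" where
  "basisv x = (\<lambda>y. if y = x then 1 else 0)"

definition charv :: "'a set \<Rightarrow> 'a cvec" where
  "charv Y = (\<lambda>y. if y \<in> Y then 1 else 0)"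

definition sym_assoc_scheme :: "nat \<Rightarrow> (nat \<Rightarrow> ('a::finite \<times> 'a) set) \<Rightarrow> bool" where
  "sym_assoc_scheme D R \<longleftrightarrow>
     R 0 = Id \<and>
     (\<forall>i\<le>D. R i \<noteq> {}) \<and>
     (\<forall>i\<le>D. \<forall>j\<le>D. i \<noteq> j \<longrightarrow> R i \<inter> R j = {}) \<and>
     (\<Union>i\<le>D. R i) = UNIV \<and>
     (\<forall>i\<le>D. \<forall>x y. (x, y) \<in> R i \<longrightarrow> (y, x) \<in> R i) \<and>
     (\<forall>i\<le>D. \<forall>j\<le>D. \<forall>k\<le>D. \<exists>p::nat. \<forall>x y. (x, y) \<in> R k \<longrightarrow>
          card {z. (x, z) \<in> R i \<and> (z, y) \<in> R j} = p)"

definition BM :: "nat \<Rightarrow> (nat \<Rightarrow> ('a \<times> 'a) set) \<Rightarrow> 'a cmat set" where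
  "BM D R = {M. \<exists>c::nat \<Rightarrow> complex. M = (\<lambda>x y. \<Sum>i\<le>D. c i * adjm (R i) x y)}"

definition idempotent :: "('a::finite) cmat \<Rightarrow> bool" where
  "idempotent F \<longleftrightarrow> mmult F F = F"

definition prim_idem :: "nat \<Rightarrow> (nat \<Rightarrow> ('a::finite \<times> 'a) set) \<Rightarrow> 'a cmat \<Rightarrow> bool" where
  "prim_idem D R F \<longleftrightarrow>
     F \<in> BM D R \<and> F \<noteq> zero_mat \<and> idempotent F \<and>
     (\<forall>G\<in>BM D R. \<forall>H\<in>BM D R. idempotent G \<longrightarrow> idempotent H \<longrightarrow>
        mmult G H = zero_mat \<longrightarrow> F = madd G H \<longrightarrow> G = zero_mat \<or> H = zero_mat)"

definition prim_idempotents ::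
    "nat \<Rightarrow> (nat \<Rightarrow> ('a::finite \<times> 'a) set) \<Rightarrow> (nat \<Rightarrow> 'a cmat) \<Rightarrow> bool" where
  "prim_idempotents D R E \<longleftrightarrow>
     (\<forall>j\<le>D. prim_idem D R (E j)) \<and> inj_on E {..D} \<and>
     (\<forall>F. prim_idem D R F \<longrightarrow> (\<exists>j\<le>D. F = E j)) \<and>
     E 0 = (\<lambda>x y. 1 / of_nat (card (UNIV :: 'a set)))"

definition graph_dist_is :: "('a \<times> 'a) set \<Rightarrow> 'a \<Rightarrow> 'a \<Rightarrow> nat \<Rightarrow> bool" where
  "graph_dist_is S x y i \<longleftrightarrow> (x, y) \<in> S ^^ i \<and> (\<forall>j<i. (x, y) \<notin> S ^^ j)"

definition metric_scheme :: "nat \<Rightarrow> (nat \<Rightarrow> ('a \<times> 'a) set) \<Rightarrow> bool" where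
  "metric_scheme D R \<longleftrightarrow>
     (\<forall>i\<le>D. \<forall>x y. (x, y) \<in> R i \<longleftrightarrow> graph_dist_is (R 1) x y i)"

text \<open>Cometric: E_j is a polynomial of degree exactly j in E_1 under entrywise product
  (the constant term corresponds to a multiple of J).\<close>
definition cometric_scheme :: "nat \<Rightarrow> (nat \<Rightarrow> 'a cmat) \<Rightarrow> bool" where
  "cometric_scheme D E \<longleftrightarrow>
     (\<forall>j\<le>D. \<exists>p :: complex poly. degree p = j \<and> E j = (\<lambda>x y. poly p (E 1 x y)))"

definition is_cycle_graph :: "('a::finite \<times> 'a) set \<Rightarrow> bool" where
  "is_cycle_graph S \<longleftrightarrow> card (UNIV :: 'a set) \<ge> 3 \<and>
     (\<exists>f :: nat \<Rightarrow> 'a. bij_betw f {..<card (UNIV :: 'a set)} UNIV \<and>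
        (\<forall>i<card (UNIV :: 'a set). \<forall>j<card (UNIV :: 'a set).
           (f i, f j) \<in> S \<longleftrightarrow> (j = (i + 1) mod card (UNIV :: 'a set) \<or> i = (j + 1) mod card (UNIV :: 'a set))))"

definition delta_star :: "nat \<Rightarrow> (nat \<Rightarrow> ('a::finite) cmat) \<Rightarrow> 'a set \<Rightarrow> nat" where
  "delta_star D E Y = (LEAST j. j \<noteq> 0 \<and> j \<le> D \<and> mvec (E j) (charv Y) \<noteq> zero_vec)"

definition dual_idem :: "(nat \<Rightarrow> ('a \<times> 'a) set) \<Rightarrow> nat \<Rightarrow> 'a \<Rightarrow> 'a cmat" where
  "dual_idem R i x = diagm (\<lambda>y. adjm (R i) x y)"

definition dual_adj :: "(nat \<Rightarrow> ('a::finite) cmat) \<Rightarrow> nat \<Rightarrow> 'a \<Rightarrow> 'a cmat" where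
  "dual_adj E i x = diagm (\<lambda>y. of_nat (card (UNIV :: 'a set)) * E i x y)"

definition lin_dep2 :: "'a cvec \<Rightarrow> 'a cvec \<Rightarrow> bool" where
  "lin_dep2 u v \<longleftrightarrow> (\<exists>a b. (a \<noteq> 0 \<or> b \<noteq> 0) \<and> (\<forall>y. a * u y + b * v y = 0))"

definition rel_codesign :: "(nat \<Rightarrow> ('a::finite \<times> 'a) set) \<Rightarrow> 'a \<Rightarrow> nat \<Rightarrow> 'a cvec \<Rightarrow> bool" where
  "rel_codesign R x t psi \<longleftrightarrow>
     (\<forall>i. 1 \<le> i \<and> i \<le> t \<longrightarrow>
        lin_dep2 (mvec (dual_idem R i x) psi) (mvec (adjm (R i)) (basisv x)))"

inductive_set Talg :: "nat \<Rightarrow> (nat \<Rightarrow> ('a::finite \<times> 'a) set) \<Rightarrow> (nat \<Rightarrow> 'a cmat) \<Rightarrow> 'a \<Rightarrow> 'a cmat set"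
  for D R E x where
  gen_BM: "M \<in> BM D R \<Longrightarrow> M \<in> Talg D R E x"
| gen_dual: "i \<le> D \<Longrightarrow> dual_adj E i x \<in> Talg D R E x"
| add: "P \<in> Talg D R E x \<Longrightarrow> Q \<in> Talg D R E x \<Longrightarrow> madd P Q \<in> Talg D R E x"
| smult: "P \<in> Talg D R E x \<Longrightarrow> msmult c P \<in> Talg D R E x"
| mult: "P \<in> Talg D R E x \<Longrightarrow> Q \<in> Talg D R E x \<Longrightarrow> mmult P Q \<in> Talg D R E x"

definition csubspace :: "'a cvec set \<Rightarrow> bool" where
  "csubspace W \<longleftrightarrow> zero_vec \<in> W \<and> (\<forall>u\<in>W. \<forall>v\<in>W. (\<lambda>y. u y + v y) \<in> W) \<and>
     (\<forall>c. \<forall>u\<in>W. (\<lambda>y. c * u y) \<in> W)"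

definition Tmodule :: "nat \<Rightarrow> (nat \<Rightarrow> ('a::finite \<times> 'a) set) \<Rightarrow> (nat \<Rightarrow> 'a cmat) \<Rightarrow> 'a \<Rightarrow> 'a cvec set \<Rightarrow> bool" where
  "Tmodule D R E x W \<longleftrightarrow> csubspace W \<and> (\<forall>T\<in>Talg D R E x. \<forall>w\<in>W. mvec T w \<in> W)"

definition irred_Tmodule :: "nat \<Rightarrow> (nat \<Rightarrow> ('a::finite \<times> 'a) set) \<Rightarrow> (nat \<Rightarrow> 'a cmat) \<Rightarrow> 'a \<Rightarrow> 'a cvec set \<Rightarrow> bool" where
  "irred_Tmodule D R E x W \<longleftrightarrow> Tmodule D R E x W \<and> W \<noteq> {zero_vec} \<and>
     (\<forall>U. Tmodule D R E x U \<and> U \<subseteq> W \<longrightarrow> U = {zero_vec} \<or> U = W)"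

definition endpoint :: "nat \<Rightarrow> (nat \<Rightarrow> ('a::finite \<times> 'a) set) \<Rightarrow> 'a \<Rightarrow> 'a cvec set \<Rightarrow> nat" where
  "endpoint D R x W = (LEAST i. i \<le> D \<and> (\<exists>w\<in>W. mvec (dual_idem R i x) w \<noteq> zero_vec))"

definition dual_endpoint :: "nat \<Rightarrow> (nat \<Rightarrow> ('a::finite) cmat) \<Rightarrow> 'a cvec set \<Rightarrow> nat" where
  "dual_endpoint D E W = (LEAST j. j \<le> D \<and> (\<exists>w\<in>W. mvec (E j) w \<noteq> zero_vec))"

definition bipartite_graph :: "('a \<times> 'a) set \<Rightarrow> bool" where
  "bipartite_graph S \<longleftrightarrow> (\<exists>P. \<forall>u v. (u, v) \<in> S \<longrightarrow> (u \<in> P \<longleftrightarrow> v \<notin> P))"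

definition bipartite_half :: "('a \<times> 'a) set \<Rightarrow> 'a set \<Rightarrow> bool" where
  "bipartite_half S Y \<longleftrightarrow> (\<forall>u v. (u, v) \<in> S \<longrightarrow> (u \<in> Y \<longleftrightarrow> v \<notin> Y))"

definition antipodal_double_cover :: "nat \<Rightarrow> (nat \<Rightarrow> ('a \<times> 'a) set) \<Rightarrow> bool" where
  "antipodal_double_cover D R \<longleftrightarrow>
     equiv UNIV {(y, z). y = z \<or> (y, z) \<in> R D} \<and>
     (\<forall>y. card {z. y = z \<or> (y, z) \<in> R D} = 2)"

end

theory Submission
  imports Defs "HOL-Analysis.Analysis"
begin

text \<open>Suppose \<open>\<delta>\<^sup>* \<le> t\<close> and let \<open>x \<in> Y\<close>. The component \<open>u\<close> of \<open>E \<chi>\<^sub>Y\<close> (with \<open>E = E\<^sub>\<delta>\<^sub>*\<close>) orthogonal to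
  the primary module vanishes on the spheres of radius at most \<open>t\<close> around \<open>x\<close>, because it is
  constant with sum zero on each of them. In an irreducible module \<open>W\<close> with \<open>r(W) \<le> r\<^sup>*(W)\<close> a split
  decomposition shows that a vector of \<open>E W\<close> cannot vanish on all these spheres, so \<open>u = 0\<close>.
  Hence all columns of \<open>E\<close> indexed by \<open>Y\<close> are proportional, and thus equal up to sign. If two points of
  \<open>Y\<close> are at a distance strictly between \<open>0\<close> and \<open>D\<close>, this forces the graph to be bipartite and
  \<open>\<delta>\<^sup>* = D\<close>, so \<open>\<chi>\<^sub>Y\<close> is a combination of the all-one and the sign vector. If all distances in \<open>Y\<close>
  equal \<open>D\<close>, then \<open>E\<^sub>1 \<chi>\<^sub>Y = 0\<close>, which gives a double cover when \<open>|Y| = 2\<close>, while for \<open>|Y| \<ge> 3\<close>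
  it contradicts \<open>E\<^sub>2\<close> being a quadratic polynomial in \<open>E\<^sub>1\<close>.\<close>

text \<open>\<open>E\<close> is real and symmetric, hence the Gram matrix of its own columns, with
  constant diagonal. So if two columns are proportional, the factor is 1 or -1, and whether two
  columns agree up to a given sign can be read off from a single entry, that is, from the distance
  between the two points. This transport turns information about a few points of \<open>Y\<close>
  into information about the whole graph. Cycles are excluded in order to have valency at least
  three: among three neighbours of one point of \<open>Y\<close>, two lie on the same side with
  respect to another point of \<open>Y\<close>, and this pigeonhole step produces points at distance
  two with equal columns. The bound on endpoints concerns irreducible modules only. Instead of
  decomposing the whole space, a minimal submodule that is not orthogonal to \<open>u\<close> is
  chosen; the projection of \<open>u\<close> to it inherits both the eigenvector property and the
  vanishing on spheres, because both are expressed by self-adjoint elements of the algebra.\<close>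

lemma two_regular_connected_is_cycle:
  fixes S :: "('a::finite \<times> 'a) set"
  assumes sym: "\<And>x y. (x, y) \<in> S \<Longrightarrow> (y, x) \<in> S" and irr: "\<And>x. (x, x) \<notin> S"
    and deg: "\<And>x. card {y. (x, y) \<in> S} = 2" and conn: "\<And>x y. (x, y) \<in> S\<^sup>*"
  shows "is_cycle_graph S"
proof -
  \<comment> \<open>The way to leave \<open>b\<close> without returning to \<open>a\<close>.\<close>
  define oth where "oth a b = (SOME c. (b, c) \<in> S \<and> c \<noteq> a)" for a b
  have ex: "\<exists>c. (b, c) \<in> S \<and> c \<noteq> a" for a b
  proof (rule ccontr)
    assume "\<nexists>c. (b, c) \<in> S \<and> c \<noteq> a"
    then have "{y. (b, y) \<in> S} \<subseteq> {a}" by blast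
    then have "card {y. (b, y) \<in> S} \<le> card {a}" by (intro card_mono) auto
    then show False using deg[of b] by simp
  qed
  have oth: "(b, oth a b) \<in> S" "oth a b \<noteq> a" for a b
    using someI_ex[OF ex[of b a]] unfolding oth_def by auto
  have nbr: "(b, y) \<in> S \<longleftrightarrow> y = a \<or> y = oth a b" if "(b, a) \<in> S" for a b y
  proof -
    have "{a, oth a b} = {y. (b, y) \<in> S}"
      by (rule card_subset_eq) (use that oth(1)[of b a] oth(2)[of a b, symmetric] deg[of b] in auto)
    then show ?thesis by blast
  qed
  obtain x0 :: 'a where True by simp
  obtain x1 where x1: "(x0, x1) \<in> S" using ex by blast
  \<comment> \<open>A walk without backtracking. The recursion carries the last edge, since the next
    vertex depends on its two ends.\<close>
  define g where "g = rec_nat (x0, x1) (\<lambda>_ p. (snd p, oth (fst p) (snd p)))"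
  define f where "f n = fst (g n)" for n
  have gS: "g (Suc n) = (snd (g n), oth (fst (g n)) (snd (g n)))" for n by (simp add: g_def)
  have f1: "f (Suc n) = snd (g n)" for n by (simp add: f_def gS)
  have f2: "f (Suc (Suc n)) = oth (f n) (f (Suc n))" for n by (simp add: f1 gS) (simp add: f_def)
  have edge: "(f n, f (Suc n)) \<in> S" for n
  proof (induction n)
    case 0
    show ?case using x1 unfolding f1 by (simp add: f_def g_def)
  next
    case (Suc n)
    show ?case unfolding f2 by (rule oth)
  qed
  have nb: "(f (Suc n), y) \<in> S \<longleftrightarrow> y = f n \<or> y = f (Suc (Suc n))" for n y
    unfolding f2 by (rule nbr[OF sym[OF edge]])
  have ne2: "f (Suc (Suc n)) \<noteq> f n" for n unfolding f2 by (rule oth)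
  have ne1: "f (Suc n) \<noteq> f n" for n using edge[of n] irr by metis
  have rep: "\<exists>n. f n \<in> f ` {..<n}"
  proof (rule ccontr)
    assume n: "\<nexists>n. f n \<in> f ` {..<n}"
    have "inj f"
    proof (rule injI)
      fix i j assume "f i = f j"
      then show "i = j" using n by (metis image_eqI lessThan_iff nat_neq_iff)
    qed
    then show False using finite_imageD[of f UNIV] by simp
  qed
  \<comment> \<open>The first return of the walk. It is a return to the start: an inner vertex of
    the walk already has its two neighbours, its predecessor and its successor, on the walk.\<close>
  define n where "n = (LEAST n. f n \<in> f ` {..<n})"
  have "f n \<in> f ` {..<n}" unfolding n_def by (rule LeastI_ex[OF rep])
  then obtain m where m: "m < n" "f n = f m" by auto
  have inj: "i = j" if "f i = f j" "i < n" "j < n" for i j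
  proof -
    have "f k \<notin> f ` {..<k}" if "k < n" for k using that not_less_Least unfolding n_def by blast
    then show ?thesis using that by (metis image_eqI lessThan_iff nat_neq_iff)
  qed
  obtain n' where n': "n = Suc n'" using m(1) by (cases n) auto
  have "m = 0"
  proof (rule ccontr)
    assume "m \<noteq> 0"
    then obtain m' where m': "m = Suc m'" by (cases m) auto
    have "(f m, f n') \<in> S" using sym[OF edge[of n']] n' m(2) by simp
    then have "f n' = f m' \<or> f n' = f (Suc m)" using nb m' by simp
    moreover have "f n' \<noteq> f m'" using inj[of n' m'] n' m' m(1) by auto
    moreover have "f n' \<noteq> f (Suc m)"
    proof
      assume *: "f n' = f (Suc m)"
      show False
      proof (cases "Suc m < n")
        case True
        then have "n' = Suc m" using inj[OF *] n' by simp
        then show False using ne2[of m] m(2) n' by simp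
      next
        case False
        then show False using m ne1[of m] by (metis Suc_lessI)
      qed
    qed
    ultimately show False by blast
  qed
  then have fn: "f n = f 0" using m(2) by simp
  have n3: "n \<ge> 3"
  proof (rule ccontr)
    assume "\<not> n \<ge> 3"
    then have "n = Suc 0 \<or> n = Suc (Suc 0)" using m(1) by linarith
    then show False using fn ne1[of 0] ne2[of 0] by auto
  qed
  have nb0: "(f 0, y) \<in> S \<longleftrightarrow> y = f n' \<or> y = f 1" for y
  proof -
    have *: "(f 0, y) \<in> S \<longleftrightarrow> y = f n' \<or> y = f (Suc n)" for y
      using nb[of n' y] n' fn by simp
    have "f 1 \<noteq> f n'" using inj[of 1 n'] n3 n' by auto
    then have "f 1 = f (Suc n)" using *[of "f 1"] edge[of 0] by simp
    then show ?thesis using * by simp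
  qed
  have fmod: "f ((i + 1) mod n) = f (Suc i)" if "i < n" for i
    using that fn by (cases "Suc i = n") auto
  have surj: "y \<in> f ` {..<n}" for y
    using conn[of "f 0" y]
  proof (induction rule: rtrancl_induct)
    case base
    show ?case using n3 by auto
  next
    case (step y z)
    then obtain i where i: "i < n" "y = f i" by auto
    have fS: "f (Suc i) \<in> f ` {..<n}" using fmod[OF i(1)] m(1) by (metis imageI lessThan_iff mod_less_divisor gr_implies_not0 neq0_conv)
    show ?case
    proof (cases i)
      case 0
      then show ?thesis using step.hyps(2) i nb0[of z] n' n3 fS by auto
    next
      case (Suc k)
      then show ?thesis using step.hyps(2) i nb[of k z] fS by auto
    qed
  qed
  have injon: "inj_on f {..<n}" using inj by (auto simp: inj_on_def)
  have img: "f ` {..<n} = UNIV" using surj by blast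
  have card: "card (UNIV :: 'a set) = n" using card_image[OF injon] img by simp
  have adj: "(f i, f j) \<in> S \<longleftrightarrow> j = (i + 1) mod n \<or> i = (j + 1) mod n" if ij: "i < n" "j < n" for i j
  proof
    assume e: "(f i, f j) \<in> S"
    have jS: "j = (i + 1) mod n" if "f j = f (Suc i)"
      using inj[of j "(i + 1) mod n"] fmod[OF ij(1)] that ij by simp
    show "j = (i + 1) mod n \<or> i = (j + 1) mod n"
    proof (cases i)
      case 0
      then have "f j = f n' \<or> f j = f (Suc i)" using e nb0 by simp
      then show ?thesis using jS inj[of j n'] ij n' 0 by auto
    next
      case (Suc k)
      then have "f j = f k \<or> f j = f (Suc i)" using e nb by simp
      then show ?thesis using jS inj[of j k] ij Suc by auto
    qed
  next
    assume "j = (i + 1) mod n \<or> i = (j + 1) mod n"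
    then show "(f i, f j) \<in> S"
      using edge[of i] sym[OF edge[of j]] fmod[OF ij(1)] fmod[OF ij(2)] by auto
  qed
  show ?thesis
    unfolding is_cycle_graph_def card
    using n3 injon img adj by (intro conjI exI[of _ f]) (auto simp: bij_betw_def)
qed

locale pq_scheme =
  fixes D :: nat and R :: "nat \<Rightarrow> ('a::finite \<times> 'a) set" and E :: "nat \<Rightarrow> 'a cmat"
  assumes scheme: "sym_assoc_scheme D R"
    and D3: "D \<ge> 3"
    and idem: "prim_idempotents D R E"
    and metric: "metric_scheme D R"
    and cometric: "cometric_scheme D E"
begin

subsection \<open>The distance function\<close>

text \<open>The index of the relation containing the pair, defined from the partition alone; only
  \<open>dst_graph\<close> brings in the metric hypothesis and identifies it with path
  distance.\<close>

definition dst :: "'a \<Rightarrow> 'a \<Rightarrow> nat" where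
  "dst x y = (THE i. i \<le> D \<and> (x, y) \<in> R i)"

lemma ex1_R: "\<exists>!i. i \<le> D \<and> (x, y) \<in> R i"
proof -
  have "(x, y) \<in> (\<Union>i\<le>D. R i)"
    using scheme by (simp add: sym_assoc_scheme_def)
  then obtain i where i: "i \<le> D" "(x, y) \<in> R i" by blast
  moreover have "j = i" if "j \<le> D" "(x, y) \<in> R j" for j
  proof (rule ccontr)
    assume "j \<noteq> i"
    then have "R j \<inter> R i = {}" using scheme i(1) that(1) by (simp add: sym_assoc_scheme_def)
    then show False using i(2) that(2) by blast
  qed
  ultimately show ?thesis by blast
qed

lemma dst_le [simp]: "dst x y \<le> D" and in_R_dst: "(x, y) \<in> R (dst x y)"
  using theI'[OF ex1_R[of x y]] unfolding dst_def by auto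

lemma R_iff: "i \<le> D \<Longrightarrow> (x, y) \<in> R i \<longleftrightarrow> dst x y = i"
  using ex1_R[of x y] dst_le[of x y] in_R_dst[of x y] by blast

lemma dst_0 [simp]: "dst x y = 0 \<longleftrightarrow> x = y"
  using scheme R_iff[of 0 x y] unfolding sym_assoc_scheme_def by auto

lemma dst_self [simp]: "dst x x = 0"
  by (simp only: dst_0)

lemma dst_sym: "dst x y = dst y x"
proof -
  have "\<forall>i\<le>D. \<forall>x y. (x, y) \<in> R i \<longrightarrow> (y, x) \<in> R i"
    using scheme unfolding sym_assoc_scheme_def by (elim conjE) assumption
  then have "(y, x) \<in> R (dst x y)" using in_R_dst dst_le by blast
  then show ?thesis using R_iff[OF dst_le] by metis
qed

lemma dst_attained:
  assumes "i \<le> D"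
  shows "\<exists>x y. dst x y = i"
proof -
  have "\<forall>i\<le>D. R i \<noteq> {}"
    using scheme unfolding sym_assoc_scheme_def by (elim conjE) assumption
  then obtain x y where "(x, y) \<in> R i" using assms by (metis equals0I surj_pair)
  then show ?thesis using R_iff[OF assms] by blast
qed

lemma card_transport:
  assumes "dst x y = dst a b"
  shows "card {z. dst x z = i \<and> dst z y = j} = card {z. dst a z = i \<and> dst z b = j}"
proof (cases "i \<le> D \<and> j \<le> D")
  case True
  have "\<forall>i\<le>D. \<forall>j\<le>D. \<forall>k\<le>D. \<exists>p::nat. \<forall>x y. (x, y) \<in> R k \<longrightarrow>
          card {z. (x, z) \<in> R i \<and> (z, y) \<in> R j} = p"
    using scheme unfolding sym_assoc_scheme_def by (elim conjE) assumption
  then obtain p where p: "\<And>x' y'. (x', y') \<in> R (dst x y) \<Longrightarrow>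
      card {z. (x', z) \<in> R i \<and> (z, y') \<in> R j} = p"
    using True dst_le[of x y] by meson
  have "card {z. dst x' z = i \<and> dst z y' = j} = p" if "dst x' y' = dst x y" for x' y'
    using p[of x' y'] that in_R_dst[of x' y'] True by (simp add: R_iff)
  from this[of x y] this[of a b] show ?thesis using assms by simp
next
  case False
  then have "{z. dst x z = i \<and> dst z y = j} = {}" "{z. dst a z = i \<and> dst z b = j} = {}"
    using dst_le by auto
  then show ?thesis by (simp only:)
qed

text \<open>An intersection number that is positive for one pair is positive for every pair at the
  same distance. Local configurations are carried around the graph in this form.\<close>

lemma ex_transport:
  assumes "dst x y = dst a b" "dst x z = i" "dst z y = j"
  shows "\<exists>c. dst a c = i \<and> dst c b = j"
proof -
  have "card {z. dst x z = i \<and> dst z y = j} \<noteq> 0" using assms(2,3) by auto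
  then have "card {z. dst a z = i \<and> dst z b = j} \<noteq> 0"
    using card_transport[OF assms(1)] by metis
  then have "{z. dst a z = i \<and> dst z b = j} \<noteq> {}" by force
  then show ?thesis by blast
qed

text \<open>Grouping \<open>z\<close> by its two distances leaves only intersection numbers as
  weights. This is what closes the Bose-Mesner algebra under multiplication.\<close>

lemma sum_transport:
  fixes F :: "nat \<Rightarrow> nat \<Rightarrow> complex"
  assumes "dst x y = dst a b"
  shows "(\<Sum>z\<in>UNIV. F (dst x z) (dst z y)) = (\<Sum>z\<in>UNIV. F (dst a z) (dst z b))"
proof -
  have *: "(\<Sum>z\<in>UNIV. F (dst x z) (dst z y)) =
      (\<Sum>i\<le>D. \<Sum>j\<le>D. of_nat (card {z. dst x z = i \<and> dst z y = j}) * F i j)" for x y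
  proof -
    have "(\<Sum>z\<in>UNIV. F (dst x z) (dst z y)) =
        (\<Sum>z\<in>UNIV. \<Sum>i\<le>D. \<Sum>j\<le>D. if dst x z = i \<and> dst z y = j then F i j else 0)"
    proof (rule sum.cong[OF refl])
      fix z
      have "(\<Sum>i\<le>D. \<Sum>j\<le>D. if dst x z = i \<and> dst z y = j then F i j else 0)
          = (\<Sum>i\<le>D. if dst x z = i then F i (dst z y) else 0)"
      proof (rule sum.cong[OF refl])
        fix i
        show "(\<Sum>j\<le>D. if dst x z = i \<and> dst z y = j then F i j else 0)
          = (if dst x z = i then F i (dst z y) else 0)"
          by (cases "dst x z = i") (simp_all add: sum.delta)
      qed
      then show "F (dst x z) (dst z y) =
          (\<Sum>i\<le>D. \<Sum>j\<le>D. if dst x z = i \<and> dst z y = j then F i j else 0)"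
        by (simp add: sum.delta)
    qed
    also have "\<dots> = (\<Sum>i\<le>D. \<Sum>z\<in>UNIV. \<Sum>j\<le>D. if dst x z = i \<and> dst z y = j then F i j else 0)"
      by (rule sum.swap)
    also have "\<dots> = (\<Sum>i\<le>D. \<Sum>j\<le>D. \<Sum>z\<in>UNIV. if dst x z = i \<and> dst z y = j then F i j else 0)"
      by (intro sum.cong refl sum.swap)
    also have "\<dots> = (\<Sum>i\<le>D. \<Sum>j\<le>D. of_nat (card {z. dst x z = i \<and> dst z y = j}) * F i j)"
      by (simp add: sum.If_cases)
    finally show ?thesis .
  qed
  show ?thesis unfolding * card_transport[OF assms] ..
qed

lemma dst_graph: "graph_dist_is (R 1) x y (dst x y)"
  using metric dst_le in_R_dst unfolding metric_scheme_def by blast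

lemma dst_le_relpow: "(x, y) \<in> R 1 ^^ n \<Longrightarrow> dst x y \<le> n"
  using dst_graph[of x y] unfolding graph_dist_is_def by (meson not_less)

lemma dst_relpow: "(x, y) \<in> R 1 ^^ dst x y"
  using dst_graph unfolding graph_dist_is_def by blast

lemma R1_iff: "(x, y) \<in> R 1 \<longleftrightarrow> dst x y = 1"
  using R_iff[of 1] D3 by simp

lemma dst_triangle: "dst x z \<le> dst x y + dst y z"
  using dst_le_relpow[of x z "dst x y + dst y z"] dst_relpow[of x y] dst_relpow[of y z]
  by (auto simp: relpow_add)

lemma closer_neighbour:
  assumes "dst x y = Suc i"
  shows "\<exists>z. dst x z = i \<and> dst z y = 1"
proof -
  have "(x, y) \<in> R 1 ^^ Suc i" using dst_relpow[of x y] assms by metis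
  then obtain z where z: "(x, z) \<in> R 1 ^^ i" "(z, y) \<in> R 1" by auto
  then have "dst z y = 1" using R1_iff by blast
  then show ?thesis
    using dst_le_relpow[OF z(1)] dst_triangle[of x y z] assms by (intro exI[of _ z]) auto
qed

lemma farther_neighbour:
  assumes "dst x y = i" "i < D"
  shows "\<exists>z. dst x z = Suc i \<and> dst z y = 1"
proof -
  \<comment> \<open>Distance \<open>Suc i\<close> occurs somewhere; the last edge of a geodesic
    there is copied to the pair \<open>x\<close>, \<open>y\<close>.\<close>
  obtain a b where ab: "dst a b = Suc i" using dst_attained[of "Suc i"] assms by auto
  then obtain c where c: "dst a c = i" "dst c b = 1" using closer_neighbour by blast
  show ?thesis
    by (rule ex_transport[of a c x y b]) (use c ab assms in \<open>auto simp: dst_sym\<close>)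
qed

lemma neighbour_cases:
  assumes "dst x y = i" "dst y z = 1"
  shows "dst x z = i \<or> dst x z = Suc i \<or> Suc (dst x z) = i"
  using dst_triangle[of x z y] dst_triangle[of x y z] assms dst_sym[of y z] by linarith

lemma ex_at_dst: "i \<le> D \<Longrightarrow> \<exists>y. dst x y = i"
proof (induction i)
  case 0
  then show ?case by (intro exI[of _ x]) simp
next
  case (Suc i)
  then show ?case using farther_neighbour[of x _ i] by fastforce
qed

lemma connected_induct:
  assumes "P x" "\<And>y z. P y \<Longrightarrow> dst y z = 1 \<Longrightarrow> P z"
  shows "P y"
proof (induction "dst x y" arbitrary: y)
  case 0
  then show ?case using assms(1) by (metis dst_0)
next
  case (Suc n)
  then show ?case using closer_neighbour[of x y n] assms(2) by metis
qed

subsection \<open>The Bose--Mesner algebra\<close>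

lemma adjm_R: "i \<le> D \<Longrightarrow> adjm (R i) x y = (if dst x y = i then 1 else 0)"
  by (simp add: adjm_def R_iff)

lemma BM_iff: "M \<in> BM D R \<longleftrightarrow> (\<forall>x y a b. dst x y = dst a b \<longrightarrow> M x y = M a b)"
proof
  assume "M \<in> BM D R"
  then obtain c where "M = (\<lambda>x y. \<Sum>i\<le>D. c i * adjm (R i) x y)" by (auto simp: BM_def)
  then show "\<forall>x y a b. dst x y = dst a b \<longrightarrow> M x y = M a b"
    by (simp add: adjm_R)
next
  assume *: "\<forall>x y a b. dst x y = dst a b \<longrightarrow> M x y = M a b"
  define p where "p i = (SOME q. dst (fst q) (snd q) = i)" for i
  have p: "dst (fst (p (dst x y))) (snd (p (dst x y))) = dst x y" for x y
    unfolding p_def by (rule someI[of _ "(x, y)"]) simp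
  have "M x y = (\<Sum>i\<le>D. M (fst (p i)) (snd (p i)) * adjm (R i) x y)" for x y
  proof -
    have "(\<Sum>i\<le>D. M (fst (p i)) (snd (p i)) * adjm (R i) x y)
        = (\<Sum>i\<le>D. if dst x y = i then M (fst (p i)) (snd (p i)) else 0)"
      by (intro sum.cong refl) (simp add: adjm_R)
    also have "\<dots> = M (fst (p (dst x y))) (snd (p (dst x y)))" by simp
    also have "\<dots> = M x y" using * p[of x y] by blast
    finally show ?thesis by (rule sym)
  qed
  then show "M \<in> BM D R"
    unfolding BM_def by (intro CollectI exI[of _ "\<lambda>i. M (fst (p i)) (snd (p i))"] ext)
qed

lemma BM_cong: "M \<in> BM D R \<Longrightarrow> dst x y = dst a b \<Longrightarrow> M x y = M a b"
  using BM_iff by blast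

lemma BM_sym: "M \<in> BM D R \<Longrightarrow> M x y = M y x"
  using BM_cong dst_sym by metis

lemma BM_dst: "(\<lambda>x y. g (dst x y)) \<in> BM D R"
  by (simp add: BM_iff)

lemma BM_pointwise:
  assumes "M \<in> BM D R" "N \<in> BM D R"
  shows "(\<lambda>x y. F (M x y) (N x y)) \<in> BM D R"
  unfolding BM_iff by (intro allI impI arg_cong2[of _ _ _ _ F] BM_cong[OF assms(1)] BM_cong[OF assms(2)])

lemma BM_fun:
  assumes "M \<in> BM D R"
  shows "\<exists>h. M = (\<lambda>x y. h (dst x y))"
proof -
  define p where "p i = (SOME q. dst (fst q) (snd q) = i)" for i
  have p: "dst (fst (p (dst x y))) (snd (p (dst x y))) = dst x y" for x y
    unfolding p_def by (rule someI[of _ "(x, y)"]) simp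
  then have "M x y = M (fst (p (dst x y))) (snd (p (dst x y)))" for x y
    by (intro BM_cong[OF assms] p[symmetric])
  then show ?thesis by (intro exI[of _ "\<lambda>i. M (fst (p i)) (snd (p i))"] ext)
qed

lemma BM_mmult:
  assumes "M \<in> BM D R" "N \<in> BM D R"
  shows "mmult M N \<in> BM D R"
proof -
  obtain g h where g: "M = (\<lambda>x y. g (dst x y))" and h: "N = (\<lambda>x y. h (dst x y))"
    using BM_fun assms by metis
  show ?thesis
    unfolding BM_iff g h mmult_def
    using sum_transport[of _ _ _ _ "\<lambda>i j. g i * h j"] by blast
qed

lemma BM_commute:
  assumes "M \<in> BM D R" "N \<in> BM D R"
  shows "mmult M N = mmult N M"
proof (intro ext)
  fix x y
  have "mmult M N x y = mmult M N y x" by (rule BM_sym[OF BM_mmult[OF assms]])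
  also have "\<dots> = mmult N M x y"
    unfolding mmult_def BM_sym[OF assms(1), of y] BM_sym[OF assms(2), of _ x]
    by (simp add: mult.commute)
  finally show "mmult M N x y = mmult N M x y" .
qed

lemma mmult_assoc: "mmult (mmult A B) C = mmult A (mmult B (C :: 'a cmat))"
proof (intro ext)
  fix x y
  have "mmult (mmult A B) C x y = (\<Sum>z\<in>UNIV. \<Sum>w\<in>UNIV. A x w * B w z * C z y)"
    by (simp add: mmult_def sum_distrib_right)
  also have "\<dots> = (\<Sum>w\<in>UNIV. \<Sum>z\<in>UNIV. A x w * B w z * C z y)" by (rule sum.swap)
  also have "\<dots> = mmult A (mmult B C) x y"
    by (simp add: mmult_def sum_distrib_left mult.assoc)
  finally show "mmult (mmult A B) C x y = mmult A (mmult B C) x y" .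
qed

lemma mmult_diff:
  "mmult (\<lambda>x y. A x y - B x y) C = (\<lambda>x y. mmult A C x y - mmult B C x y)"
  "mmult C (\<lambda>x y. A x y - B x y) = (\<lambda>x y. mmult C A x y - mmult C B x y)"
  for A B C :: "'a cmat"
  by (simp_all add: mmult_def fun_eq_iff algebra_simps sum_subtractf)

section \<open>Primitive idempotents: orthogonality, reality, basis property\<close>

lemma E_BM: "j \<le> D \<Longrightarrow> E j \<in> BM D R"
  and E_idem: "j \<le> D \<Longrightarrow> mmult (E j) (E j) = E j"
  and E_nonzero: "j \<le> D \<Longrightarrow> E j \<noteq> zero_mat"
  and E_prim: "j \<le> D \<Longrightarrow> prim_idem D R (E j)"
  using idem by (auto simp: prim_idempotents_def prim_idem_def idempotent_def)

lemma E_0: "E 0 x y = 1 / of_nat (card (UNIV :: 'a set))"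
  using idem by (simp add: prim_idempotents_def)

text \<open>\<open>E j\<close> is the sum of the orthogonal idempotents \<open>E j * G\<close> and
  \<open>E j - E j * G\<close>, and primitivity makes one of them vanish.\<close>

lemma prim_absorb:
  assumes j: "j \<le> D" and G: "G \<in> BM D R" "mmult G G = G"
  shows "mmult (E j) G = zero_mat \<or> mmult (E j) G = E j"
proof -
  define A where "A = mmult (E j) G"
  define B where "B = (\<lambda>x y. E j x y - A x y)"
  have A: "A \<in> BM D R" unfolding A_def by (rule BM_mmult[OF E_BM[OF j] G(1)])
  have B: "B \<in> BM D R" unfolding B_def by (rule BM_pointwise[OF E_BM[OF j] A])
  have EA: "mmult (E j) A = A" unfolding A_def using E_idem[OF j] mmult_assoc by metis
  then have AE: "mmult A (E j) = A" using BM_commute[OF A E_BM[OF j]] by simp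
  have "mmult A A = mmult (mmult A (E j)) G" unfolding A_def mmult_assoc ..
  also have "\<dots> = mmult (E j) (mmult G G)" unfolding AE unfolding A_def mmult_assoc ..
  finally have AA: "mmult A A = A" unfolding G(2) A_def .
  have BB: "mmult B B = B" and AB: "mmult A B = zero_mat"
    unfolding B_def mmult_diff AA EA AE E_idem[OF j] by (simp_all add: zero_mat_def)
  have "E j = madd A B" by (simp add: madd_def B_def)
  then have "A = zero_mat \<or> B = zero_mat"
    using E_prim[OF j] A B AA BB AB unfolding prim_idem_def idempotent_def by blast
  then show ?thesis
    unfolding B_def A_def by (auto simp: zero_mat_def fun_eq_iff)
qed

lemma E_orth:
  assumes "j \<le> D" "l \<le> D" "j \<noteq> l"
  shows "mmult (E j) (E l) = zero_mat"
proof (rule ccontr)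
  assume n: "mmult (E j) (E l) \<noteq> zero_mat"
  then have "mmult (E j) (E l) = E j"
    using prim_absorb[OF assms(1) E_BM E_idem] assms(2) by blast
  moreover have "mmult (E l) (E j) = E l"
    using prim_absorb[OF assms(2) E_BM E_idem] assms(1) n
      BM_commute[OF E_BM[OF assms(1)] E_BM[OF assms(2)]] by auto
  ultimately have "E j = E l"
    using BM_commute[OF E_BM[OF assms(1)] E_BM[OF assms(2)]] by simp
  then show False
    using idem assms by (auto simp: prim_idempotents_def inj_on_def)
qed

lemma E_mult:
  assumes "j \<le> D" "l \<le> D"
  shows "(\<Sum>z\<in>UNIV. E j x z * E l z y) = (if j = l then E j x y else 0)"
  using E_idem[OF assms(1)] E_orth[OF assms]
  by (auto simp: mmult_def zero_mat_def fun_eq_iff)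

lemma E_sym: "j \<le> D \<Longrightarrow> E j x y = E j y x"
  using BM_sym E_BM by blast

lemma E_cong: "j \<le> D \<Longrightarrow> dst x y = dst a b \<Longrightarrow> E j x y = E j a b"
  using BM_cong E_BM by blast

lemma sum_mult_cnj_eq_0:
  fixes f :: "'a \<Rightarrow> complex"
  assumes "(\<Sum>z\<in>UNIV. f z * cnj (f z)) = 0"
  shows "f z = 0"
proof -
  have "(\<Sum>z\<in>UNIV. f z * cnj (f z)) = of_real (\<Sum>z\<in>UNIV. (cmod (f z))\<^sup>2)"
    by (simp only: of_real_sum complex_norm_square)
  then have "(\<Sum>z\<in>UNIV. (cmod (f z))\<^sup>2) = 0" using assms by (metis of_real_eq_0_iff)
  then show ?thesis by (simp add: sum_nonneg_eq_0_iff)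
qed

text \<open>The complex conjugate \<open>F\<close> is again an idempotent of the algebra. The
  diagonal of \<open>E j * F\<close> consists of squared row norms, so the product is nonzero and
  equals \<open>E j\<close> by absorption; conjugating this equation shows that it equals
  \<open>F\<close> too.\<close>

lemma E_real:
  assumes j: "j \<le> D"
  shows "cnj (E j x y) = E j x y"
proof -
  define F where "F = (\<lambda>x y. cnj (E j x y))"
  have F: "F \<in> BM D R" unfolding F_def by (rule BM_pointwise[OF E_BM[OF j] E_BM[OF j]])
  have FF: "mmult F F = F"
  proof (intro ext)
    fix x y
    have "mmult F F x y = cnj (mmult (E j) (E j) x y)" by (simp add: mmult_def F_def)
    then show "mmult F F x y = F x y" by (simp add: E_idem[OF j] F_def)
  qed
  have nz: "mmult (E j) F \<noteq> zero_mat"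
  proof
    assume 0: "mmult (E j) F = zero_mat"
    have "E j x y = 0" for x y
    proof (rule sum_mult_cnj_eq_0[of "E j x"])
      have "(\<Sum>z\<in>UNIV. E j x z * cnj (E j x z)) = mmult (E j) F x x"
        unfolding mmult_def F_def by (subst E_sym[OF j, of _ x]) simp
      then show "(\<Sum>z\<in>UNIV. E j x z * cnj (E j x z)) = 0" using 0 by (simp add: zero_mat_def)
    qed
    then show False using E_nonzero[OF j] by (simp add: zero_mat_def fun_eq_iff)
  qed
  then have EF: "mmult (E j) F = E j" using prim_absorb[OF j F FF] by blast
  have "mmult F (E j) = F"
  proof (intro ext)
    fix x y
    have "mmult F (E j) x y = cnj (mmult (E j) F x y)" by (simp add: mmult_def F_def)
    then show "mmult F (E j) x y = F x y" unfolding EF by (simp add: F_def)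
  qed
  then have "F = E j" using EF BM_commute[OF F E_BM[OF j]] by simp
  then show ?thesis unfolding F_def by metis
qed

lemma E_diag_const: "j \<le> D \<Longrightarrow> E j x x = E j y y"
  using E_cong[of j x x y y] dst_0 by metis

lemma E_diag_nonzero:
  assumes j: "j \<le> D"
  shows "E j x x \<noteq> 0"
proof
  assume 0: "E j x x = 0"
  have "E j a b = 0" for a b
  proof (rule sum_mult_cnj_eq_0[of "E j a"])
    have "(\<Sum>z\<in>UNIV. E j a z * cnj (E j a z)) = (\<Sum>z\<in>UNIV. E j a z * E j z a)"
      unfolding E_real[OF j] by (subst E_sym[OF j, of _ a]) simp
    also have "\<dots> = E j a a" using E_mult[OF j j] by simp
    finally show "(\<Sum>z\<in>UNIV. E j a z * cnj (E j a z)) = 0"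
      using 0 E_diag_const[OF j, of a x] by simp
  qed
  then show False using E_nonzero[OF j] by (simp add: zero_mat_def fun_eq_iff)
qed

text \<open>The \<open>D + 1\<close> orthogonal idempotents are independent, hence a basis, by comparison with
  the \<open>D + 1\<close> associate matrices.\<close>

lemma BM_span_E:
  assumes M: "M \<in> BM D R"
  shows "\<exists>c. \<forall>x y. M x y = (\<Sum>j\<le>D. c j * E j x y)"
proof -
  \<comment> \<open>Matrices become coordinate vectors over pairs of points, so that linear algebra
    over the complex numbers applies.\<close>
  define V :: "'a cmat \<Rightarrow> complex ^ ('a \<times> 'a)" where "V m = (\<chi> p. m (fst p) (snd p))" for m
  define B where "B = (\<lambda>j. V (E j)) ` {..D}"
  define G where "G = (\<lambda>i. V (adjm (R i))) ` {..D}"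
  have inj: "inj_on (\<lambda>j. V (E j)) {..D}"
  proof (rule inj_onI)
    fix j l assume jl: "j \<in> {..D}" "l \<in> {..D}" "V (E j) = V (E l)"
    have "E j = E l"
      using jl(3) by (auto simp: V_def vec_eq_iff fun_eq_iff)
    then show "j = l" using idem jl by (auto simp: prim_idempotents_def inj_on_def)
  qed
  have spanG: "V N \<in> vec.span G" if N: "N \<in> BM D R" for N
  proof -
    obtain c where "N = (\<lambda>x y. \<Sum>i\<le>D. c i * adjm (R i) x y)" using N by (auto simp: BM_def)
    then have "V N = (\<Sum>i\<le>D. c i *s V (adjm (R i)))"
      by (simp add: V_def vec_eq_iff)
    also have "\<dots> \<in> vec.span G"
      by (intro vec.span_sum vec.span_scale vec.span_base) (auto simp: G_def)
    finally show ?thesis .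
  qed
  have fin: "finite B" "finite G" by (auto simp: B_def G_def)
  \<comment> \<open>Multiplying the relation by \<open>E l\<close> isolates one coefficient; a
    diagonal entry of \<open>E l\<close> is nonzero.\<close>
  have coeff0: "c l = 0"
    if c: "(\<Sum>j\<le>D. c j *s V (E j)) = 0" and l: "l \<le> D" for c l
  proof -
    have z: "(\<Sum>j\<le>D. c j * E j x y) = 0" for x y
      using c by (simp add: V_def vec_eq_iff)
    have "0 = (\<Sum>w\<in>UNIV. (\<Sum>j\<le>D. c j * E j x w) * E l w x)" for x by (simp add: z)
    also have "(\<Sum>w\<in>UNIV. (\<Sum>j\<le>D. c j * E j x w) * E l w x)
        = (\<Sum>w\<in>UNIV. \<Sum>j\<le>D. c j * (E j x w * E l w x))" for x
      by (simp add: sum_distrib_right mult.assoc)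
    also have "(\<Sum>w\<in>UNIV. \<Sum>j\<le>D. c j * (E j x w * E l w x))
        = (\<Sum>j\<le>D. \<Sum>w\<in>UNIV. c j * (E j x w * E l w x))" for x
      by (rule sum.swap)
    also have "(\<Sum>j\<le>D. \<Sum>w\<in>UNIV. c j * (E j x w * E l w x))
        = (\<Sum>j\<le>D. if j = l then c l * E l x x else 0)" for x
      by (intro sum.cong refl) (use l in \<open>auto simp: E_mult sum_distrib_left[symmetric]\<close>)
    finally have "c l * E l x x = 0" for x using l by (simp add: sum.delta)
    then show ?thesis using E_diag_nonzero[OF l] by simp
  qed
  have indep: "vec.independent B"
  proof
    assume "vec.dependent B"
    then obtain u where u: "(\<Sum>v\<in>B. u v *s v) = 0" "\<exists>v\<in>B. u v \<noteq> 0"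
      using vec.dependent_finite[OF fin(1)] by blast
    have "(\<Sum>v\<in>B. u v *s v) = (\<Sum>j\<le>D. u (V (E j)) *s V (E j))"
      unfolding B_def by (simp add: sum.reindex[OF inj])
    then have "u (V (E l)) = 0" if "l \<le> D" for l
      using coeff0[of "\<lambda>j. u (V (E j))" l] u(1) that by simp
    then show False using u(2) by (auto simp: B_def)
  qed
  have "V M \<in> vec.span B"
  \<comment> \<open>Otherwise \<open>D + 2\<close> independent vectors would lie in the span of the
    \<open>D + 1\<close> associate matrices.\<close>
  proof (rule ccontr)
    assume n: "V M \<notin> vec.span B"
    then have nB: "V M \<notin> B" using vec.span_base by blast
    have "vec.independent (insert (V M) B)" using n indep by (simp add: vec.independent_insert)
    moreover have "insert (V M) B \<subseteq> vec.span G"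
      using spanG M E_BM by (auto simp: B_def)
    ultimately have "card (insert (V M) B) \<le> card G"
      using vec.independent_span_bound[OF fin(2)] by blast
    moreover have "card (insert (V M) B) = Suc (Suc D)"
      using nB fin by (simp add: B_def card_image[OF inj])
    moreover have "card G \<le> Suc D" unfolding G_def using card_image_le[of "{..D}"] by fastforce
    ultimately show False by simp
  qed
  then obtain u where "V M = (\<Sum>v\<in>B. u v *s v)"
    unfolding vec.span_finite[OF fin(1)] by auto
  also have "\<dots> = (\<Sum>j\<le>D. u (V (E j)) *s V (E j))"
    unfolding B_def by (simp add: sum.reindex[OF inj])
  finally have "\<forall>x y. M x y = (\<Sum>j\<le>D. u (V (E j)) * E j x y)"
    by (simp add: V_def vec_eq_iff)
  then show ?thesis by (rule exI[of _ "\<lambda>j. u (V (E j))"])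
qed

lemma BM_eigen:
  assumes M: "M \<in> BM D R"
  shows "\<exists>\<theta>. \<forall>j\<le>D. \<forall>x y. (\<Sum>z\<in>UNIV. M x z * E j z y) = \<theta> j * E j x y"
proof -
  obtain c where c: "\<And>x y. M x y = (\<Sum>j\<le>D. c j * E j x y)" using BM_span_E[OF M] by blast
  have "(\<Sum>z\<in>UNIV. M x z * E j z y) = c j * E j x y" if j: "j \<le> D" for j x y
  proof -
    have "(\<Sum>z\<in>UNIV. M x z * E j z y) = (\<Sum>z\<in>UNIV. \<Sum>l\<le>D. c l * (E l x z * E j z y))"
      by (simp add: c sum_distrib_right mult.assoc)
    also have "\<dots> = (\<Sum>l\<le>D. \<Sum>z\<in>UNIV. c l * (E l x z * E j z y))" by (rule sum.swap)
    also have "\<dots> = (\<Sum>l\<le>D. if l = j then c j * E j x y else 0)"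
      by (intro sum.cong refl) (use j in \<open>auto simp: E_mult sum_distrib_left[symmetric]\<close>)
    finally show ?thesis using j by (simp add: sum.delta)
  qed
  then show ?thesis by blast
qed

lemma sum_E: "(\<Sum>j\<le>D. E j x y) = (if x = y then 1 else 0)"
proof -
  define I where "I = (\<lambda>x y. if dst x y = 0 then 1 else 0 :: complex)"
  have I: "I \<in> BM D R" unfolding I_def by (rule BM_dst)
  obtain c where c: "\<And>x y. I x y = (\<Sum>j\<le>D. c j * E j x y)" using BM_span_E[OF I] by blast
  have "c l = 1" if l: "l \<le> D" for l
  proof -
    have "E l x x = (\<Sum>z\<in>UNIV. I x z * E l z x)"
      by (simp add: I_def sum.delta if_distrib if_distribR cong: if_cong)
    also have "\<dots> = (\<Sum>z\<in>UNIV. \<Sum>j\<le>D. c j * (E j x z * E l z x))"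
      by (simp add: c sum_distrib_right mult.assoc)
    also have "\<dots> = (\<Sum>j\<le>D. \<Sum>z\<in>UNIV. c j * (E j x z * E l z x))" by (rule sum.swap)
    also have "\<dots> = (\<Sum>j\<le>D. if j = l then c l * E l x x else 0)"
      by (intro sum.cong refl) (use l in \<open>auto simp: E_mult sum_distrib_left[symmetric]\<close>)
    finally show ?thesis using l E_diag_nonzero[OF l, of x] by (simp add: sum.delta)
  qed
  then have "(\<Sum>j\<le>D. E j x y) = I x y" unfolding c by simp
  then show ?thesis by (simp add: I_def)
qed

subsection \<open>The cometric structure\<close>

text \<open>Equality in Cauchy-Schwarz: the squared norm of column \<open>x\<close> minus
  \<open>s\<close> times column \<open>y\<close> is
  \<open>E j x x - 2 * s * E j x y + E j y y\<close>, which vanishes under the hypothesis on one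
  entry.\<close>

lemma E_column:
  assumes j: "j \<le> D" and s: "s = 1 \<or> s = (-1 :: complex)" and e: "E j x y = s * E j x x"
  shows "E j z x = s * E j z y"
proof -
  define f where "f z = E j z x - s * E j z y" for z
  have ss: "s * s = 1" using s by auto
  have "f z * cnj (f z) = E j x z * E j z x - 2 * s * (E j x z * E j z y) + E j y z * E j z y" for z
  proof -
    have "cnj (f z) = f z" using s E_real[OF j] by (auto simp: f_def)
    then have "f z * cnj (f z) = f z * f z" by simp
    also have "\<dots> = E j z x * E j z x - 2 * s * (E j z x * E j z y) + (s * s) * (E j z y * E j z y)"
      by (simp add: f_def algebra_simps)
    finally have "f z * cnj (f z) = E j z x * E j z x - 2 * s * (E j z x * E j z y) + (s * s) * (E j z y * E j z y)" .
    then show ?thesis using E_sym[OF j, of z x] E_sym[OF j, of z y] ss by simp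
  qed
  then have "(\<Sum>z\<in>UNIV. f z * cnj (f z)) = E j x x - 2 * s * E j x y + E j y y"
    using E_mult[OF j j] by (simp add: sum.distrib sum_subtractf sum_distrib_left[symmetric])
  also have "\<dots> = 0"
    unfolding e using ss E_diag_const[OF j, of y x] by (simp add: algebra_simps)
  finally have "f z = 0" by (rule sum_mult_cnj_eq_0)
  then show ?thesis by (simp add: f_def)
qed

lemma E_poly: "j \<le> D \<Longrightarrow> \<exists>p. degree p = j \<and> (\<forall>x y. E j x y = poly p (E 1 x y))"
  using cometric unfolding cometric_scheme_def by (metis (no_types, lifting))

text \<open>All \<open>E j\<close> are polynomials in the entries of \<open>E 1\<close>, so every
  matrix of the algebra is a function of these entries, including the indicator of a single
  distance.\<close>

lemma E1_inj:
  assumes "E 1 x y = E 1 a b"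
  shows "dst x y = dst a b"
proof -
  define M where "M = (\<lambda>u v. if dst u v = dst x y then 1 else 0 :: complex)"
  have "M \<in> BM D R" unfolding M_def by (rule BM_dst)
  then obtain c where c: "\<And>x y. M x y = (\<Sum>j\<le>D. c j * E j x y)" using BM_span_E by blast
  have "E j x y = E j a b" if "j \<le> D" for j
    using E_poly[OF that] assms by metis
  then have "M x y = M a b" unfolding c by simp
  then show ?thesis by (simp add: M_def split: if_splits)
qed

lemma degree_reduce:
  fixes p q :: "complex poly"
  assumes "degree p \<le> Suc n" "degree q = Suc n"
  shows "degree (p - smult (coeff p (Suc n) / coeff q (Suc n)) q) \<le> n"
proof (rule degree_le, intro allI impI)
  fix i assume "n < i"
  have "coeff q (Suc n) \<noteq> 0" using assms(2) by (metis leading_coeff_0_iff degree_0 nat.distinct(1))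
  then show "coeff (p - smult (coeff p (Suc n) / coeff q (Suc n)) q) i = 0"
    using \<open>n < i\<close> assms by (cases "i = Suc n") (simp_all add: coeff_eq_0)
qed

lemma poly_span_E:
  assumes "n \<le> D" "degree p \<le> n"
  shows "\<exists>c. \<forall>x y. poly p (E 1 x y) = (\<Sum>j\<le>n. c j * E j x y)"
  using assms
proof (induction n arbitrary: p)
  case 0
  then obtain a where "p = [:a:]" by (metis degree_eq_zeroE le_zero_eq)
  \<comment> \<open>Constants are multiples of \<open>E 0\<close>, whose entries are all one over
    the number of points.\<close>
  then show ?case
    by (intro exI[of _ "\<lambda>_. a * of_nat (card (UNIV :: 'a set))"]) (simp add: E_0)
next
  case (Suc n)
  obtain q where q: "degree q = Suc n" "\<And>x y. E (Suc n) x y = poly q (E 1 x y)"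
    using E_poly[OF Suc.prems(1)] by blast
  define k where "k = coeff p (Suc n) / coeff q (Suc n)"
  obtain c where c: "\<And>x y. poly (p - smult k q) (E 1 x y) = (\<Sum>j\<le>n. c j * E j x y)"
    using Suc.IH[of "p - smult k q"] degree_reduce[OF Suc.prems(2) q(1)] Suc.prems(1)
    unfolding k_def by auto
  have "poly p (E 1 x y) = (\<Sum>j\<le>Suc n. (c(Suc n := k)) j * E j x y)" for x y
    using c[of x y] q(2)[of x y] by (simp add: algebra_simps)
  then show ?case by blast
qed

section \<open>Krein parameters\<close>

lemma sum_E_E:
  assumes "j \<le> D" "i \<le> D"
  shows "(\<Sum>x\<in>UNIV. \<Sum>y\<in>UNIV. E j x y * E i x y)
    = (if j = i then of_nat (card (UNIV :: 'a set)) * E j a a else 0)"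
proof -
  have "(\<Sum>y\<in>UNIV. E j x y * E i x y) = (if j = i then E j a a else 0)" for x
    unfolding E_sym[OF assms(2), of x] E_mult[OF assms] using E_diag_const[OF assms(1), of x a] by auto
  then show ?thesis by simp
qed

text \<open>The Krein parameter \<open>q\<^bsup>i\<^esup>\<^bsub>hl\<^esub>\<close> up to a nonzero factor.\<close>

definition krein :: "nat \<Rightarrow> nat \<Rightarrow> nat \<Rightarrow> complex" where
  "krein h l i = (\<Sum>x\<in>UNIV. \<Sum>y\<in>UNIV. E h x y * E l x y * E i x y)"

lemma krein_expand:
  assumes "n \<le> D" "i \<le> D" "\<And>x y. E h x y * E l x y = (\<Sum>j\<le>n. c j * E j x y)"
  shows "krein h l i = (if i \<le> n then c i * (of_nat (card (UNIV :: 'a set)) * E i a a) else 0)"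
proof -
  have "krein h l i = (\<Sum>x\<in>UNIV. \<Sum>y\<in>UNIV. \<Sum>j\<le>n. c j * (E j x y * E i x y))"
    unfolding krein_def by (simp add: assms(3) sum_distrib_right mult.assoc)
  also have "\<dots> = (\<Sum>x\<in>UNIV. \<Sum>j\<le>n. \<Sum>y\<in>UNIV. c j * (E j x y * E i x y))"
    by (intro sum.cong refl sum.swap)
  also have "\<dots> = (\<Sum>j\<le>n. \<Sum>x\<in>UNIV. \<Sum>y\<in>UNIV. c j * (E j x y * E i x y))"
    by (rule sum.swap)
  also have "\<dots> = (\<Sum>j\<le>n. if j = i then c i * (of_nat (card (UNIV :: 'a set)) * E i a a) else 0)"
    by (intro sum.cong refl)
      (use assms(1,2) in \<open>auto simp: sum_distrib_left[symmetric] sum_E_E[of _ _ a]\<close>)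
  finally show ?thesis by (simp add: sum.delta)
qed

text \<open>The entrywise product of \<open>E 1\<close> and \<open>E l\<close> is a polynomial of
  degree at most \<open>l + 1\<close> in \<open>E 1\<close>, so only idempotents up to index
  \<open>l + 1\<close> occur in it.\<close>

lemma krein_zero:
  assumes "i \<le> D" "Suc l < i"
  shows "krein 1 l i = 0"
proof -
  have l: "l \<le> D" "Suc l \<le> D" using assms by auto
  obtain p where p: "degree p = l" "\<And>x y. E l x y = poly p (E 1 x y)"
    using E_poly[OF l(1)] by blast
  have "degree (pCons 0 p) \<le> Suc l" using p(1) by (metis degree_pCons_le)
  then obtain c where "\<And>x y. poly (pCons 0 p) (E 1 x y) = (\<Sum>j\<le>Suc l. c j * E j x y)"
    using poly_span_E[OF l(2)] by blast
  then have "\<And>x y. E 1 x y * E l x y = (\<Sum>j\<le>Suc l. c j * E j x y)" using p(2) by simp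
  from krein_expand[OF l(2) assms(1) this] show ?thesis using assms by simp
qed

lemma krein_nonzero:
  assumes l: "Suc l \<le> D"
  shows "krein 1 l (Suc l) \<noteq> 0"
proof -
  have l': "l \<le> D" using l by auto
  obtain p where p: "degree p = l" "\<And>x y. E l x y = poly p (E 1 x y)"
    using E_poly[OF l'] by blast
  obtain q where q: "degree q = Suc l" "\<And>x y. E (Suc l) x y = poly q (E 1 x y)"
    using E_poly[OF l] by blast
  have "p \<noteq> 0" using p(2) E_diag_nonzero[OF l'] by force
  have d: "degree (pCons 0 p) \<le> Suc l" using p(1) by (metis degree_pCons_le)
  \<comment> \<open>The quotient of leading coefficients is the coefficient of
    \<open>E (Suc l)\<close> in the entrywise product, and neither leading coefficient is
    zero.\<close>
  define k where "k = coeff (pCons 0 p) (Suc l) / coeff q (Suc l)"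
  have "coeff p l \<noteq> 0" using \<open>p \<noteq> 0\<close> p(1) by auto
  moreover have "coeff q (Suc l) \<noteq> 0"
    using q(1) by (metis leading_coeff_0_iff degree_0 nat.distinct(1))
  ultimately have k: "k \<noteq> 0" by (simp add: k_def)
  obtain c where c: "\<And>x y. poly (pCons 0 p - smult k q) (E 1 x y) = (\<Sum>j\<le>l. c j * E j x y)"
    using poly_span_E[OF l' degree_reduce[OF d q(1)]] unfolding k_def by blast
  have "E 1 x y * E l x y = (\<Sum>j\<le>Suc l. (c(Suc l := k)) j * E j x y)" for x y
    using c[of x y] p(2)[of x y] q(2)[of x y] by (simp add: algebra_simps)
  from krein_expand[OF l l this, where a = undefined] show ?thesis
    using k E_diag_nonzero[OF l] by simp
qed

text \<open>The squared Frobenius norm of \<open>E\<^sub>i A\<^sub>1\<^sup>* E\<^sub>l\<close> is a multiple of a Krein parameter.\<close>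

lemma triple_product_zero:
  assumes il: "i \<le> D" "Suc l < i"
  shows "(\<Sum>y\<in>UNIV. E i a y * E 1 x y * E l y b) = 0"
proof -
  have l: "l \<le> D" and o: "1 \<le> D" using il D3 by auto
  define f where "f a b = (\<Sum>y\<in>UNIV. E i a y * E 1 x y * E l y b)" for a b
  \<comment> \<open>The eigenvalue of this entrywise product on \<open>E 1\<close> is the Krein
    parameter up to a nonzero factor, hence zero.\<close>
  define M where "M = (\<lambda>y z. E i y z * E l y z)"
  have "M \<in> BM D R" unfolding M_def by (rule BM_pointwise[OF E_BM[OF il(1)] E_BM[OF l]])
  then obtain \<theta> where "\<And>j x y. j \<le> D \<Longrightarrow> (\<Sum>z\<in>UNIV. M x z * E j z y) = \<theta> j * E j x y"
    using BM_eigen by blast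
  from this[OF o] have th: "(\<Sum>z\<in>UNIV. M x z * E 1 z y) = \<theta> 1 * E 1 x y" for x y .
  have "0 = krein 1 l i" using krein_zero[OF il] by simp
  also have "\<dots> = (\<Sum>y\<in>UNIV. \<Sum>z\<in>UNIV. M y z * E 1 z y)"
  proof -
    have "E 1 y z * E l y z * E i y z = M y z * E 1 z y" for y z
      unfolding M_def E_sym[OF o, of z y] by (simp add: mult.commute mult.left_commute)
    then show ?thesis by (simp only: krein_def)
  qed
  also have "\<dots> = \<theta> 1 * (of_nat (card (UNIV :: 'a set)) * E 1 x x)"
  proof -
    have "(\<Sum>y\<in>UNIV. \<theta> 1 * E 1 y y) = (\<Sum>y\<in>(UNIV :: 'a set). \<theta> 1 * E 1 x x)"
      by (intro sum.cong refl arg_cong2[of _ _ _ _ "(*)"] E_diag_const[OF o])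
    then show ?thesis by (simp only: th sum_constant mult.left_commute)
  qed
  finally have th0: "\<theta> 1 = 0" using E_diag_nonzero[OF o] by simp
  \<comment> \<open>Summing over \<open>b\<close> contracts \<open>E l\<close> with itself, summing
    over \<open>a\<close> does the same for \<open>E i\<close>. What remains is the quadratic form
    of \<open>M\<close> at the row of \<open>E 1\<close>, which the zero eigenvalue kills.\<close>
  have "(\<Sum>a\<in>UNIV. \<Sum>b\<in>UNIV. f a b * cnj (f a b))
      = (\<Sum>a\<in>UNIV. \<Sum>b\<in>UNIV. \<Sum>y\<in>UNIV. \<Sum>z\<in>UNIV.
          (E 1 x y * E 1 x z) * (E i y a * E i a z) * (E l y b * E l b z))"
  proof -
    have "E i a y * E 1 x y * E l y b * (E i a z * E 1 x z * E l z b)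
        = (E 1 x y * E 1 x z) * (E i y a * E i a z) * (E l y b * E l b z)" for a b y z
      unfolding E_sym[OF il(1), of y a] E_sym[OF l, of b z]
      by (simp add: mult.commute mult.left_commute)
    then show ?thesis
      by (simp only: f_def cnj_sum complex_cnj_mult E_real[OF o] E_real[OF l] E_real[OF il(1)] sum_product)
  qed
  also have "\<dots> = (\<Sum>a\<in>UNIV. \<Sum>y\<in>UNIV. \<Sum>b\<in>UNIV. \<Sum>z\<in>UNIV.
          (E 1 x y * E 1 x z) * (E i y a * E i a z) * (E l y b * E l b z))"
    by (intro sum.cong refl sum.swap)
  also have "\<dots> = (\<Sum>a\<in>UNIV. \<Sum>y\<in>UNIV. \<Sum>z\<in>UNIV. \<Sum>b\<in>UNIV.
          (E 1 x y * E 1 x z) * (E i y a * E i a z) * (E l y b * E l b z))"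
    by (intro sum.cong refl sum.swap)
  also have "\<dots> = (\<Sum>a\<in>UNIV. \<Sum>y\<in>UNIV. \<Sum>z\<in>UNIV.
          (E 1 x y * E 1 x z) * (E i y a * E i a z) * E l y z)"
    by (simp add: sum_distrib_left[symmetric] E_mult[OF l l])
  also have "\<dots> = (\<Sum>y\<in>UNIV. \<Sum>a\<in>UNIV. \<Sum>z\<in>UNIV.
          (E 1 x y * E 1 x z) * (E i y a * E i a z) * E l y z)"
    by (rule sum.swap)
  also have "\<dots> = (\<Sum>y\<in>UNIV. \<Sum>z\<in>UNIV. \<Sum>a\<in>UNIV.
          (E 1 x y * E 1 x z) * (E i y a * E i a z) * E l y z)"
    by (intro sum.cong refl sum.swap)
  also have "\<dots> = (\<Sum>y\<in>UNIV. \<Sum>z\<in>UNIV. (E 1 x y * E 1 x z) * E i y z * E l y z)"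
    by (simp add: sum_distrib_left[symmetric] sum_distrib_right[symmetric] E_mult[OF il(1) il(1)])
  also have "\<dots> = (\<Sum>y\<in>UNIV. E 1 x y * (\<Sum>z\<in>UNIV. M y z * E 1 z x))"
  proof -
    have "E 1 x y * E 1 x z * E i y z * E l y z = E 1 x y * (M y z * E 1 z x)" for y z
      unfolding M_def E_sym[OF o, of z x] by (simp add: mult.commute mult.left_commute)
    then show ?thesis by (simp only: sum_distrib_left)
  qed
  also have "\<dots> = 0" by (simp only: th th0) simp
  finally have "(\<Sum>a\<in>UNIV. \<Sum>b\<in>UNIV. f a b * cnj (f a b)) = 0" .
  then have "(\<Sum>p\<in>UNIV. (case p of (a, b) \<Rightarrow> f a b * cnj (f a b))) = 0"
    by (simp add: sum.cartesian_product)
  then have "(\<Sum>p\<in>UNIV. f (fst p) (snd p) * cnj (f (fst p) (snd p))) = 0"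
    by (simp add: case_prod_unfold)
  then have "of_real (\<Sum>p\<in>UNIV. (cmod (f (fst p) (snd p)))\<^sup>2) = (0 :: complex)"
    by (simp only: of_real_sum complex_norm_square)
  then have "(\<Sum>p\<in>UNIV. (cmod (f (fst p) (snd p)))\<^sup>2) = 0" by (metis of_real_eq_0_iff)
  then have "\<forall>p. f (fst p) (snd p) = 0" by (simp add: sum_nonneg_eq_0_iff)
  then show ?thesis unfolding f_def by (metis fst_conv snd_conv)
qed

subsection \<open>Subspaces and modules\<close>

lemma csub_zero: "csubspace W \<Longrightarrow> zero_vec \<in> W"
  and csub_add: "csubspace W \<Longrightarrow> u \<in> W \<Longrightarrow> v \<in> W \<Longrightarrow> (\<lambda>y. u y + v y) \<in> W"
  and csub_scale: "csubspace W \<Longrightarrow> u \<in> W \<Longrightarrow> (\<lambda>y. c * u y) \<in> W"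
  by (auto simp: csubspace_def)

lemma csub_diff:
  assumes W: "csubspace W" and u: "u \<in> W" and v: "v \<in> W"
  shows "(\<lambda>y. u y - v y) \<in> W"
  using csub_add[OF W u csub_scale[OF W v, of "-1"]] by simp

lemma csub_sum:
  assumes W: "csubspace W" and "finite I" "\<And>i. i \<in> I \<Longrightarrow> f i \<in> W"
  shows "(\<lambda>y. \<Sum>i\<in>I. f i y) \<in> W"
  using assms(2,3)
proof (induction rule: finite_induct)
  case empty
  then show ?case using csub_zero[OF W] by (simp add: Defs.zero_vec_def)
next
  case (insert i I)
  then have "(\<lambda>y. f i y + (\<Sum>i\<in>I. f i y)) \<in> W" by (intro csub_add[OF W]) auto
  then show ?case using insert.hyps by simp
qed

lemma mvec_add: "mvec M (\<lambda>y. u y + v y) = (\<lambda>y. mvec M u y + mvec M v y)"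
  and mvec_diff: "mvec M (\<lambda>y. u y - v y) = (\<lambda>y. mvec M u y - mvec M v y)"
  and mvec_scale: "mvec M (\<lambda>y. c * u y) = (\<lambda>y. c * mvec M u y)"
  and mvec_zero: "mvec M zero_vec = zero_vec"
  for M :: "'a cmat"
  by (simp_all add: mvec_def Defs.zero_vec_def fun_eq_iff algebra_simps sum.distrib sum_subtractf sum_distrib_left)

lemma mvec_sum: "mvec M (\<lambda>y. \<Sum>i\<in>I. f i y) = (\<lambda>y. \<Sum>i\<in>I. mvec M (f i) y)"
  for M :: "'a cmat"
proof
  fix y
  show "mvec M (\<lambda>y. \<Sum>i\<in>I. f i y) y = (\<Sum>i\<in>I. mvec M (f i) y)"
    unfolding mvec_def sum_distrib_left by (rule sum.swap)
qed

lemma mvec_mmult: "mvec (mmult P Q) v = mvec P (mvec Q v)" for P :: "'a cmat"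
proof
  fix x
  have "mvec (mmult P Q) v x = (\<Sum>z\<in>UNIV. \<Sum>w\<in>UNIV. P x w * (Q w z * v z))"
    by (simp add: mvec_def mmult_def sum_distrib_right mult.assoc)
  also have "\<dots> = (\<Sum>w\<in>UNIV. \<Sum>z\<in>UNIV. P x w * (Q w z * v z))" by (rule sum.swap)
  also have "\<dots> = mvec P (mvec Q v) x" by (simp add: mvec_def sum_distrib_left)
  finally show "mvec (mmult P Q) v x = mvec P (mvec Q v) x" .
qed

lemma mvec_diagm: "mvec (diagm h) v = (\<lambda>y. h y * v y)" for h :: "'a cvec"
proof
  fix y
  have "mvec (diagm h) v y = (\<Sum>z\<in>UNIV. if y = z then h y * v z else 0)"
    unfolding mvec_def diagm_def by (intro sum.cong) auto
  then show "mvec (diagm h) v y = h y * v y" by simp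
qed

section \<open>Hermitian product, projections and dimension\<close>

definition ip :: "'a cvec \<Rightarrow> 'a cvec \<Rightarrow> complex" where
  "ip u v = (\<Sum>y\<in>UNIV. u y * cnj (v y))"

lemma ip_self: "ip v v = 0 \<Longrightarrow> v = zero_vec"
  unfolding ip_def Defs.zero_vec_def using sum_mult_cnj_eq_0[of v] by blast

lemma ip_add_right: "ip u (\<lambda>y. v y + w y) = ip u v + ip u w"
  by (simp add: ip_def algebra_simps sum.distrib)

lemma ip_BM:
  assumes "\<And>x y. M x y = M y x" "\<And>x y. cnj (M x y) = M x y"
  shows "ip (mvec M u) v = ip u (mvec M v)"
proof -
  have "ip (mvec M u) v = (\<Sum>y\<in>UNIV. \<Sum>z\<in>UNIV. M y z * u z * cnj (v y))"
    by (simp add: ip_def mvec_def sum_distrib_right)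
  also have "\<dots> = (\<Sum>z\<in>UNIV. \<Sum>y\<in>UNIV. M y z * u z * cnj (v y))" by (rule sum.swap)
  also have "\<dots> = ip u (mvec M v)"
  proof -
    have "M y z * u z * cnj (v y) = u z * (cnj (M z y) * cnj (v y))" for y z
      unfolding assms(2) assms(1)[of y z] by simp
    then show ?thesis by (simp only: ip_def mvec_def sum_distrib_left cnj_sum complex_cnj_mult)
  qed
  finally show ?thesis .
qed

text \<open>Complex subspaces are viewed as real ones, so that orthogonal projection and dimension
  in Euclidean space apply to them.\<close>

lemma subspace_image:
  assumes W: "csubspace W"
  shows "subspace ((vec_lambda :: 'a cvec \<Rightarrow> complex ^ 'a) ` W)"
proof (rule subspaceI)
  have "(0 :: complex ^ 'a) = vec_lambda zero_vec" by (simp add: Defs.zero_vec_def vec_eq_iff)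
  then show "0 \<in> (vec_lambda :: 'a cvec \<Rightarrow> complex ^ 'a) ` W" using csub_zero[OF W] by blast
next
  fix p q :: "complex ^ 'a" assume "p \<in> vec_lambda ` W" "q \<in> vec_lambda ` W"
  then obtain u v where uv: "p = vec_lambda u" "q = vec_lambda v" "u \<in> W" "v \<in> W" by blast
  then have "p + q = vec_lambda (\<lambda>y. u y + v y)" by (simp add: vec_eq_iff)
  then show "p + q \<in> vec_lambda ` W" using csub_add[OF W uv(3,4)] by blast
next
  fix c :: real and p :: "complex ^ 'a" assume "p \<in> vec_lambda ` W"
  then obtain u where u: "p = vec_lambda u" "u \<in> W" by blast
  then have "c *\<^sub>R p = vec_lambda (\<lambda>y. of_real c * u y)"
    by (simp add: vec_eq_iff scaleR_conv_of_real[where 'a = complex])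
  then show "c *\<^sub>R p \<in> vec_lambda ` W" using csub_scale[OF W u(2)] by blast
qed

text \<open>A complex subspace is closed under multiplication by \<open>\<i>\<close>, so orthogonality for the real
  inner product \<open>Re (ip u v)\<close> already gives orthogonality for \<open>ip\<close>.\<close>

lemma orthogonal_decomposition:
  assumes W: "csubspace W"
  shows "\<exists>w\<in>W. \<forall>n\<in>W. ip (\<lambda>y. u y - w y) n = 0"
proof -
  let ?V = "vec_lambda :: 'a cvec \<Rightarrow> complex ^ 'a"
  obtain p z where p: "p \<in> span (?V ` W)" and z: "\<And>q. q \<in> span (?V ` W) \<Longrightarrow> orthogonal z q"
    and u: "?V u = p + z"
    using orthogonal_subspace_decomp_exists[of "?V ` W" "?V u"] by blast
  have sp: "span (?V ` W) = ?V ` W" using subspace_image[OF W] by (simp add: span_eq_iff)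
  obtain w where w: "w \<in> W" "p = ?V w" using p sp by auto
  have z_eq: "z $ i = u i - w i" for i
    using u w(2) by (metis add_diff_cancel_left' vec_lambda_beta vector_minus_component)
  have re: "Re (ip (\<lambda>y. u y - w y) n) = 0" if n: "n \<in> W" for n
  proof -
    have "inner z (?V n) = 0" using z[of "?V n"] n sp by (auto simp: orthogonal_def)
    then show ?thesis
      by (simp add: inner_vec_def z_eq ip_def inner_complex_def)
  qed
  have "ip (\<lambda>y. u y - w y) n = 0" if n: "n \<in> W" for n
  proof -
    have "ip (\<lambda>y. u y - w y) (\<lambda>y. \<i> * n y) = - \<i> * ip (\<lambda>y. u y - w y) n"
      by (simp add: ip_def sum_distrib_left algebra_simps sum_negf sum_subtractf)
    then have "Im (ip (\<lambda>y. u y - w y) n) = 0"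
      using re[OF csub_scale[OF W n, of \<i>]] by simp
    then show ?thesis using re[OF n] by (simp add: complex_eq_iff)
  qed
  then show ?thesis using w(1) by blast
qed

text \<open>Dimension over the reals. It only has to grow along proper inclusions, so the factor two
  is harmless.\<close>

definition rdim :: "'a cvec set \<Rightarrow> nat" where
  "rdim W = dim ((vec_lambda :: 'a cvec \<Rightarrow> complex ^ 'a) ` W)"

lemma rdim_psubset:
  assumes "csubspace U" "csubspace W" "U \<subset> W"
  shows "rdim U < rdim W"
proof -
  let ?V = "vec_lambda :: 'a cvec \<Rightarrow> complex ^ 'a"
  have "inj ?V" by (metis injI vec_lambda_inverse UNIV_I)
  then have "?V ` U \<subset> ?V ` W" using assms(3) by (metis image_strict_mono inj_on_subset subset_UNIV)
  then have "span (?V ` U) \<subset> span (?V ` W)"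
    using subspace_image[OF assms(1)] subspace_image[OF assms(2)] by (simp add: span_eq_iff[THEN iffD2])
  then show ?thesis unfolding rdim_def by (rule dim_psubset)
qed

section \<open>Submodules tested on two generators\<close>

lemma mvec_adjm_sum:
  "mvec (\<lambda>x y. \<Sum>i\<le>n. c i * adjm (R i) x y) v = (\<lambda>y. \<Sum>i\<le>n. c i * mvec (adjm (R i)) v y)"
proof
  fix y
  have "mvec (\<lambda>x y. \<Sum>i\<le>n. c i * adjm (R i) x y) v y
      = (\<Sum>z\<in>UNIV. \<Sum>i\<le>n. c i * (adjm (R i) y z * v z))"
    by (simp add: mvec_def sum_distrib_right mult.assoc)
  also have "\<dots> = (\<Sum>i\<le>n. \<Sum>z\<in>UNIV. c i * (adjm (R i) y z * v z))" by (rule sum.swap)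
  finally show "mvec (\<lambda>x y. \<Sum>i\<le>n. c i * adjm (R i) x y) v y = (\<Sum>i\<le>n. c i * mvec (adjm (R i)) v y)"
    by (simp add: mvec_def sum_distrib_left)
qed

text \<open>The product of the first and the \<open>m\<close>-th associate matrix involves only
  indices up to \<open>m + 1\<close>, and index \<open>m + 1\<close> with nonzero coefficient.
  Solving for that term gives invariance under every associate matrix by induction.\<close>

lemma mvec_BM_closed:
  assumes W: "csubspace W" and A: "\<And>v. v \<in> W \<Longrightarrow> mvec (adjm (R 1)) v \<in> W"
    and M: "M \<in> BM D R" and v: "v \<in> W"
  shows "mvec M v \<in> W"
proof -
  have adj: "mvec (adjm (R l)) v \<in> W" if "l \<le> D" for l
    using that
  proof (induction l rule: less_induct)
    case (less l)
    show ?case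
    proof (cases l)
      case 0
      have "adjm (R 0) = diagm (\<lambda>_. 1)"
        by (simp add: adjm_R diagm_def fun_eq_iff)
      then show ?thesis using 0 v by (simp add: mvec_diagm)
    next
      case (Suc m)
      have m: "m \<le> D" "Suc m \<le> D" using less.prems Suc by auto
      define B where "B = mmult (adjm (R 1)) (adjm (R m))"
      have "adjm (R i) \<in> BM D R" if "i \<le> D" for i
        unfolding BM_iff using that by (simp add: adjm_R)
      then have "B \<in> BM D R" unfolding B_def using m D3 by (intro BM_mmult) auto
      then obtain c where c: "B = (\<lambda>x y. \<Sum>i\<le>D. c i * adjm (R i) x y)" by (auto simp: BM_def)
      have cB: "c (dst x y) = B x y" for x y
      proof -
        have "B x y = (\<Sum>i\<le>D. if dst x y = i then c i else 0)"
          unfolding c by (intro sum.cong refl) (simp add: adjm_R)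
        then show ?thesis by simp
      qed
      have B: "B x y = of_nat (card {z. dst x z = 1 \<and> dst z y = m})" for x y
      proof -
        have "B x y = (\<Sum>z\<in>UNIV. if dst x z = 1 \<and> dst z y = m then 1 else 0)"
          unfolding B_def mmult_def using m D3 by (intro sum.cong refl) (simp add: adjm_R)
        then show ?thesis by (simp add: sum.If_cases)
      qed
      have c0: "c i = 0" if i: "Suc m < i" "i \<le> D" for i
      proof -
        obtain x y where xy: "dst x y = i" using dst_attained[OF i(2)] by blast
        have "{z. dst x z = 1 \<and> dst z y = m} = {}"
        proof -
          have "\<not> (dst x z = 1 \<and> dst z y = m)" for z
            using dst_triangle[of x y z] xy i(1) by auto
          then show ?thesis by blast
        qed
        then have "B x y = 0" unfolding B by (simp only: card.empty of_nat_0)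
        then show ?thesis using cB[of x y] xy by simp
      qed
      have c1: "c (Suc m) \<noteq> 0"
      proof -
        obtain x y where xy: "dst x y = Suc m" using dst_attained[OF m(2)] by blast
        then obtain z where "dst y z = m" "dst z x = 1"
          using closer_neighbour[of y x m] by (metis dst_sym)
        then have "z \<in> {z. dst x z = 1 \<and> dst z y = m}" by (simp add: dst_sym)
        then have "B x y \<noteq> 0" unfolding B by (metis card_gt_0_iff empty_iff finite of_nat_eq_0_iff neq0_conv)
        then show ?thesis using cB[of x y] xy by simp
      qed
      have "B = (\<lambda>x y. \<Sum>i\<le>Suc m. c i * adjm (R i) x y)"
      proof (intro ext)
        fix x y
        show "B x y = (\<Sum>i\<le>Suc m. c i * adjm (R i) x y)"
          unfolding c by (rule sum.mono_neutral_right) (use m c0 in auto)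
      qed
      then have Bv: "mvec B v = (\<lambda>y. \<Sum>i\<le>Suc m. c i * mvec (adjm (R i)) v y)"
        by (simp only: mvec_adjm_sum)
      have "mvec B v \<in> W"
        unfolding B_def mvec_mmult using less.IH[of m] Suc m A by simp
      moreover have "(\<lambda>y. \<Sum>i\<le>m. c i * mvec (adjm (R i)) v y) \<in> W"
        using less.IH Suc m by (intro csub_sum[OF W] csub_scale[OF W]) auto
      ultimately have "(\<lambda>y. mvec B v y - (\<Sum>i\<le>m. c i * mvec (adjm (R i)) v y)) \<in> W"
        by (rule csub_diff[OF W])
      then have "(\<lambda>y. c (Suc m) * mvec (adjm (R (Suc m))) v y) \<in> W"
        by (simp add: Bv)
      from csub_scale[OF W this, of "inverse (c (Suc m))"] show ?thesis
        using c1 Suc by (simp add: mult.assoc[symmetric])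
    qed
  qed
  obtain c where c: "M = (\<lambda>x y. \<Sum>i\<le>D. c i * adjm (R i) x y)" using M by (auto simp: BM_def)
  show ?thesis
    unfolding c mvec_adjm_sum using adj by (intro csub_sum[OF W] csub_scale[OF W]) auto
qed

lemma diag_poly_closed:
  assumes W: "csubspace W" and d: "\<And>v. v \<in> W \<Longrightarrow> (\<lambda>y. g y * v y) \<in> W" and v: "v \<in> W"
  shows "(\<lambda>y. poly p (g y) * v y) \<in> W"
proof (induction p)
  case 0
  then show ?case using csub_zero[OF W] by (simp add: Defs.zero_vec_def)
next
  case (pCons a p)
  have "(\<lambda>y. a * v y + g y * (poly p (g y) * v y)) \<in> W"
    by (rule csub_add[OF W csub_scale[OF W v] d[OF pCons.IH]])
  then show ?case by (simp add: algebra_simps)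
qed

text \<open>Metric and cometric structure reduce the two families of generators to one matrix each:
  the adjacency matrix, and the diagonal matrix of row \<open>x\<close> of \<open>E 1\<close>, of
  which all other rows are polynomials.\<close>

lemma Tmodule_generators:
  assumes W: "csubspace W" and A: "\<And>v. v \<in> W \<Longrightarrow> mvec (adjm (R 1)) v \<in> W"
    and d: "\<And>v. v \<in> W \<Longrightarrow> (\<lambda>y. E 1 x y * v y) \<in> W"
  shows "Tmodule D R E x W"
proof -
  have "\<forall>v\<in>W. mvec T v \<in> W" if "T \<in> Talg D R E x" for T
    using that
  proof (induction rule: Talg.induct)
    case (gen_BM M)
    then show ?case using mvec_BM_closed[OF W A] by blast
  next
    case (gen_dual i)
    obtain p where p: "\<And>x y. E i x y = poly p (E 1 x y)" using E_poly[OF gen_dual] by blast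
    show ?case
    proof
      fix v assume "v \<in> W"
      then have "(\<lambda>y. of_nat CARD('a) * (poly p (E 1 x y) * v y)) \<in> W"
        by (intro csub_scale[OF W] diag_poly_closed[OF W d])
      then show "mvec (dual_adj E i x) v \<in> W"
        by (simp add: dual_adj_def mvec_diagm p mult.assoc)
    qed
  next
    case (add P Q)
    show ?case
    proof
      fix v assume "v \<in> W"
      then have "(\<lambda>y. mvec P v y + mvec Q v y) \<in> W" using add.IH by (intro csub_add[OF W]) auto
      then show "mvec (madd P Q) v \<in> W"
        by (simp add: mvec_def madd_def algebra_simps sum.distrib)
    qed
  next
    case (smult P c)
    show ?case
    proof
      fix v assume "v \<in> W"
      then have "(\<lambda>y. c * mvec P v y) \<in> W" using smult.IH by (intro csub_scale[OF W]) auto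
      then show "mvec (msmult c P) v \<in> W"
        by (simp add: mvec_def msmult_def sum_distrib_left mult.assoc)
    qed
  next
    case (mult P Q)
    then show ?case by (simp add: mvec_mmult)
  qed
  then show ?thesis using W by (simp add: Tmodule_def)
qed

lemma
  assumes T: "Tmodule D R E x W"
  shows Tmodule_csubspace: "csubspace W"
    and Tmodule_BM: "M \<in> BM D R \<Longrightarrow> v \<in> W \<Longrightarrow> mvec M v \<in> W"
    and Tmodule_diag: "v \<in> W \<Longrightarrow> (\<lambda>y. h (dst x y) * v y) \<in> W"
proof -
  show W: "csubspace W" using T by (simp add: Tmodule_def)
  show "mvec M v \<in> W" if "M \<in> BM D R" "v \<in> W"
    using T that(2) Talg.gen_BM[OF that(1)] unfolding Tmodule_def by blast
  show "(\<lambda>y. h (dst x y) * v y) \<in> W" if v: "v \<in> W"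
  proof -
    \<comment> \<open>A diagonal matrix depending only on the distance from \<open>x\<close> is a
      combination of dual adjacency matrices; this covers the projections to the spheres around
      \<open>x\<close>.\<close>
    obtain c where c: "\<And>x y. h (dst x y) = (\<Sum>j\<le>D. c j * E j x y)"
      using BM_span_E[OF BM_dst[of h]] by blast
    have "(\<lambda>y. c j * E j x y * v y) \<in> W" if "j \<le> D" for j
    proof -
      have "mvec (dual_adj E j x) v \<in> W"
        using T v Talg.gen_dual[OF that, where R = R and E = E and x = x]
        unfolding Tmodule_def by blast
      from csub_scale[OF W this, of "c j / of_nat CARD('a)"] show ?thesis
        by (simp add: dual_adj_def mvec_diagm mult.assoc)
    qed
    then have "(\<lambda>y. \<Sum>j\<le>D. c j * E j x y * v y) \<in> W" by (intro csub_sum[OF W]) auto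
    then show ?thesis by (simp add: c sum_distrib_right)
  qed
qed

section \<open>Spectral components and the split decomposition\<close>

lemma mvec_E_E:
  assumes "j \<le> D" "l \<le> D"
  shows "mvec (E j) (mvec (E l) v) = (if j = l then mvec (E j) v else zero_vec)"
  using E_idem[OF assms(1)] E_orth[OF assms]
  by (auto simp: mvec_mmult[symmetric]) (simp add: mvec_def zero_mat_def Defs.zero_vec_def)

lemma sum_mvec_E: "(\<Sum>j\<le>D. mvec (E j) v y) = v y"
proof -
  have "(\<Sum>j\<le>D. mvec (E j) v y) = (\<Sum>z\<in>UNIV. \<Sum>j\<le>D. E j y z * v z)"
    unfolding mvec_def by (rule sum.swap)
  also have "\<dots> = (\<Sum>z\<in>UNIV. (if y = z then 1 else 0) * v z)"
    by (simp only: sum_distrib_right[symmetric] sum_E)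
  also have "\<dots> = (\<Sum>z\<in>UNIV. if y = z then v z else 0)"
    by (intro sum.cong refl) simp
  finally show ?thesis by simp
qed

lemma zero_if_all_components_zero:
  assumes "\<And>j. j \<le> D \<Longrightarrow> mvec (E j) v = zero_vec"
  shows "v = zero_vec"
proof
  fix y
  have "v y = (\<Sum>j\<le>D. mvec (E j) v y)" by (rule sum_mvec_E[symmetric])
  also have "\<dots> = 0" by (intro sum.neutral) (simp add: assms Defs.zero_vec_def)
  finally show "v y = zero_vec y" by (simp add: Defs.zero_vec_def)
qed

text \<open>The dual of the triangle inequality: by \<open>triple_product_zero\<close>, multiplying
  by row \<open>x\<close> of \<open>E 1\<close> moves a component in the range of \<open>E l\<close>
  only to indices at most \<open>l + 1\<close>.\<close>

lemma dual_adj_raises_by_one: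
  assumes v: "\<And>l. l \<le> D \<Longrightarrow> k < l \<Longrightarrow> mvec (E l) v = zero_vec"
    and j: "j \<le> D" "Suc k < j"
  shows "mvec (E j) (\<lambda>y. E 1 x y * v y) = zero_vec"
proof
  fix b
  have v_eq: "v y = (\<Sum>l\<le>D. mvec (E l) v y)" for y by (rule sum_mvec_E[symmetric])
  have "mvec (E j) (\<lambda>y. E 1 x y * v y) b = (\<Sum>y\<in>UNIV. E j b y * (E 1 x y * (\<Sum>l\<le>D. mvec (E l) v y)))"
    unfolding mvec_def[of "E j"] v_eq[symmetric] ..
  also have "\<dots> = (\<Sum>y\<in>UNIV. \<Sum>l\<le>D. E j b y * E 1 x y * mvec (E l) v y)"
    by (simp only: sum_distrib_left mult.assoc)
  also have "\<dots> = (\<Sum>l\<le>D. \<Sum>y\<in>UNIV. E j b y * E 1 x y * mvec (E l) v y)"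
    by (rule sum.swap)
  also have "\<dots> = 0"
  proof (rule sum.neutral, intro ballI)
    fix l assume l: "l \<in> {..D}"
    show "(\<Sum>y\<in>UNIV. E j b y * E 1 x y * mvec (E l) v y) = 0"
    proof (cases "k < l")
      case True
      then show ?thesis using v[of l] l by (simp add: Defs.zero_vec_def)
    next
      case False
      have "(\<Sum>y\<in>UNIV. E j b y * E 1 x y * mvec (E l) v y)
          = (\<Sum>y\<in>UNIV. \<Sum>z\<in>UNIV. E j b y * E 1 x y * E l y z * v z)"
        by (simp only: mvec_def sum_distrib_left mult.assoc)
      also have "\<dots> = (\<Sum>z\<in>UNIV. \<Sum>y\<in>UNIV. E j b y * E 1 x y * E l y z * v z)"
        by (rule sum.swap)
      also have "\<dots> = 0"
        using triple_product_zero[OF j(1), of l] False j(2)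
        by (simp add: sum_distrib_right[symmetric])
      finally show ?thesis .
    qed
  qed
  finally show "mvec (E j) (\<lambda>y. E 1 x y * v y) b = zero_vec b" by (simp add: Defs.zero_vec_def)
qed

text \<open>The subspace \<open>S\<close> below is a split decomposition: \<open>A\<^sub>1 - \<theta>\<^sub>k\<close> lowers and \<open>A\<^sub>1\<^sup>* - \<theta>\<^sup>*\<close>
  raises the index of the summands \<open>U k\<close>, so \<open>S\<close> is a submodule, and it misses \<open>E\<^sub>r\<^sup>* N\<close> for
  the endpoint \<open>r\<close>.\<close>

lemma split_vanish:
  assumes irr: "irred_Tmodule D R E x N" and w: "w \<in> N"
    and Ew: "mvec (E \<delta>) w = w" and van: "\<And>y. dst x y \<le> t \<Longrightarrow> w y = 0"
    and \<delta>t: "\<delta> \<le> t" "t \<le> D"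
    and ep: "endpoint D R x N \<le> dual_endpoint D E N"
  shows "w = zero_vec"
proof (rule ccontr)
  assume wn: "w \<noteq> zero_vec"
  \<comment> \<open>The shift for which vanishing up to distance \<open>t\<close> is the support
    condition of \<open>U \<delta>\<close>. The final contradiction rests on
    \<open>c \<ge> 1\<close>.\<close>
  define c where "c = t + 1 - \<delta>"
  have c: "c \<ge> 1" "\<delta> + c = Suc t" using \<delta>t by (auto simp: c_def)
  have T: "Tmodule D R E x N" using irr by (simp add: irred_Tmodule_def)
  note N = Tmodule_csubspace[OF T]
  define U where "U k = {v \<in> N. (\<forall>y. dst x y < k + c \<longrightarrow> v y = 0) \<and>
      (\<forall>j\<le>D. k < j \<longrightarrow> mvec (E j) v = zero_vec)}" for k
  have U: "csubspace (U k)" for k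
    unfolding csubspace_def
  proof (intro conjI ballI allI)
    show "zero_vec \<in> U k"
      unfolding U_def using csub_zero[OF N] by (simp add: mvec_zero) (simp add: Defs.zero_vec_def)
    show "(\<lambda>y. u y + v y) \<in> U k" if "u \<in> U k" "v \<in> U k" for u v
      using that csub_add[OF N, of u v] unfolding U_def by (auto simp: mvec_add Defs.zero_vec_def)
    show "(\<lambda>y. a * u y) \<in> U k" if "u \<in> U k" for a u
      using that csub_scale[OF N, of u a] unfolding U_def by (auto simp: mvec_scale Defs.zero_vec_def)
  qed
  define S where "S = {v. \<exists>f. (\<forall>k\<le>D. f k \<in> U k) \<and> v = (\<lambda>y. \<Sum>k\<le>D. f k y)}"
  have S: "csubspace S"
    unfolding csubspace_def
  proof (intro conjI ballI allI)
    show "zero_vec \<in> S"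
      unfolding S_def using csub_zero[OF U]
      by (intro CollectI exI[of _ "\<lambda>_. zero_vec"]) (auto simp: Defs.zero_vec_def)
    show "(\<lambda>y. u y + v y) \<in> S" if uv: "u \<in> S" "v \<in> S" for u v
    proof -
      obtain f g where "\<forall>k\<le>D. f k \<in> U k" "u = (\<lambda>y. \<Sum>k\<le>D. f k y)"
        "\<forall>k\<le>D. g k \<in> U k" "v = (\<lambda>y. \<Sum>k\<le>D. g k y)" using uv unfolding S_def by blast
      then show ?thesis unfolding S_def
        by (intro CollectI exI[of _ "\<lambda>k y. f k y + g k y"])
          (auto simp: sum.distrib intro: csub_add[OF U])
    qed
    show "(\<lambda>y. a * u y) \<in> S" if u: "u \<in> S" for a u
    proof -
      obtain f where "\<forall>k\<le>D. f k \<in> U k" "u = (\<lambda>y. \<Sum>k\<le>D. f k y)"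
        using u unfolding S_def by blast
      then show ?thesis unfolding S_def
        by (intro CollectI exI[of _ "\<lambda>k y. a * f k y"])
          (auto simp: sum_distrib_left intro: csub_scale[OF U])
    qed
  qed
  have US: "v \<in> S" if "k \<le> D" "v \<in> U k" for k v
  proof -
    define f where "f i = (if i = k then v else zero_vec)" for i
    have "f i \<in> U i" for i using that csub_zero[OF U] by (simp add: f_def)
    moreover have "v = (\<lambda>y. \<Sum>i\<le>D. f i y)"
    proof
      fix y
      have "(\<Sum>i\<le>D. f i y) = (\<Sum>i\<le>D. if i = k then v y else 0)"
        by (intro sum.cong refl) (simp add: f_def Defs.zero_vec_def)
      then show "v y = (\<Sum>i\<le>D. f i y)" using that by simp
    qed
    ultimately show ?thesis unfolding S_def by blast
  qed
  have A1: "adjm (R 1) \<in> BM D R" unfolding BM_iff using D3 by (simp add: adjm_R)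
  have A1_entry: "adjm (R 1) y z = (if dst y z = 1 then 1 else 0)" for y z
    by (rule adjm_R) (use D3 in simp)
  obtain \<theta> where \<theta>: "\<And>j x y. j \<le> D \<Longrightarrow>
      (\<Sum>z\<in>UNIV. adjm (R 1) x z * E j z y) = \<theta> j * E j x y" using BM_eigen[OF A1] by blast
  have EA: "mvec (E j) (mvec (adjm (R 1)) v) = (\<lambda>y. \<theta> j * mvec (E j) v y)" if j: "j \<le> D" for j v
  proof -
    have "mmult (E j) (adjm (R 1)) = msmult (\<theta> j) (E j)"
      unfolding BM_commute[OF E_BM[OF j] A1] by (simp only: mmult_def msmult_def \<theta>[OF j])
    then have "mvec (E j) (mvec (adjm (R 1)) v) = mvec (msmult (\<theta> j) (E j)) v"
      by (simp only: mvec_mmult[symmetric])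
    then show ?thesis by (simp add: mvec_def msmult_def sum_distrib_left mult.assoc)
  qed
  have SA: "mvec (adjm (R 1)) v \<in> S" if vU: "v \<in> U k" and k: "k \<le> D" for v k
  proof -
    \<comment> \<open>Subtracting the eigenvalue removes the component of index \<open>k\<close>,
      while adjacency brings the support at most one step closer to \<open>x\<close>. So
      \<open>u\<close> lies in the summand below, or is zero if \<open>k = 0\<close>.\<close>
    define u where "u = (\<lambda>y. mvec (adjm (R 1)) v y - \<theta> k * v y)"
    have vN: "v \<in> N" and v0: "\<And>y. dst x y < k + c \<Longrightarrow> v y = 0"
      and vE: "\<And>j. j \<le> D \<Longrightarrow> k < j \<Longrightarrow> mvec (E j) v = zero_vec" using vU by (auto simp: U_def)
    have uN: "u \<in> N" unfolding u_def by (intro csub_diff[OF N] csub_scale[OF N] Tmodule_BM[OF T A1] vN)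
    have uE: "mvec (E j) u = zero_vec" if "j \<le> D" "k \<le> j" for j
      using vE[of j] that unfolding u_def mvec_diff EA[OF that(1)] mvec_scale
      by (cases "k = j") (simp_all add: Defs.zero_vec_def)
    have "u \<in> S"
    proof (cases k)
      case 0
      then have "u = zero_vec" using uE by (simp add: zero_if_all_components_zero)
      then show ?thesis using csub_zero[OF S] by simp
    next
      case (Suc m)
      have "u y = 0" if y: "dst x y < m + c" for y
      proof -
        have "adjm (R 1) y z * v z = 0" for z
          using v0[of z] dst_triangle[of x z y] y Suc by (simp add: A1_entry[simplified])
        then have "mvec (adjm (R 1)) v y = 0" unfolding mvec_def by (intro sum.neutral) blast
        then show ?thesis using v0[of y] y Suc by (simp add: u_def)
      qed
      then have "u \<in> U m" using uN uE Suc by (simp add: U_def)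
      then show ?thesis using US[of m u] k Suc by simp
    qed
    then have "(\<lambda>y. u y + \<theta> k * v y) \<in> S"
      using US[OF k vU] by (intro csub_add[OF S] csub_scale[OF S])
    then show ?thesis by (simp add: u_def)
  qed
  have SD: "(\<lambda>y. E 1 x y * v y) \<in> S" if vU: "v \<in> U k" and k: "k \<le> D" for v k
  proof -
    have vN: "v \<in> N" and v0: "\<And>y. dst x y < k + c \<Longrightarrow> v y = 0"
      and vE: "\<And>j. j \<le> D \<Longrightarrow> k < j \<Longrightarrow> mvec (E j) v = zero_vec" using vU by (auto simp: U_def)
    show ?thesis
    \<comment> \<open>If \<open>k + c\<close> exceeds the diameter, no vertex is left to support
      \<open>v\<close>. In the other case \<open>c \<ge> 1\<close> gives
      \<open>Suc k \<le> D\<close>, so the next summand exists.\<close>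
    proof (cases "k + c \<le> D")
      case False
      then have "dst x y < k + c" for y using dst_le[of x y] by linarith
      then have "(\<lambda>y. E 1 x y * v y) = zero_vec" using v0 by (simp add: Defs.zero_vec_def)
      then show ?thesis using csub_zero[OF S] by simp
    next
      case True
      obtain a where a: "dst x a = k + c" using ex_at_dst[OF True] by blast
      \<comment> \<open>\<open>E 1 x a\<close> is the value on the innermost sphere of the support;
        subtracting it clears that sphere.\<close>
      define u where "u = (\<lambda>y. E 1 x y * v y - E 1 x a * v y)"
      obtain h where h: "\<And>x y. E 1 x y = h (dst x y)"
        using BM_fun[OF E_BM, of 1] D3 by auto
      have uN: "u \<in> N" unfolding u_def h
        by (intro csub_diff[OF N] csub_scale[OF N] Tmodule_diag[OF T] vN)
      have uE: "mvec (E j) u = zero_vec" if "j \<le> D" "Suc k < j" for j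
        using dual_adj_raises_by_one[OF vE that, of x] vE[of j] that
        unfolding u_def mvec_diff mvec_scale by (simp add: Defs.zero_vec_def)
      have u0: "u y = 0" if y: "dst x y < Suc k + c" for y
      proof (cases "dst x y = k + c")
        case True
        then show ?thesis unfolding u_def h a by simp
      next
        case False
        then show ?thesis using v0[of y] y by (simp add: u_def)
      qed
      have "u \<in> U (Suc k)" using uN uE u0 by (simp add: U_def)
      then have "u \<in> S" using US[of "Suc k" u] True c by simp
      then have "(\<lambda>y. u y + E 1 x a * v y) \<in> S"
        using US[OF k vU] by (intro csub_add[OF S] csub_scale[OF S])
      then show ?thesis by (simp add: u_def)
    qed
  qed
  have TS: "Tmodule D R E x S"
  proof (rule Tmodule_generators[OF S])
    fix v assume "v \<in> S"
    then obtain f where f: "\<forall>k\<le>D. f k \<in> U k" "v = (\<lambda>y. \<Sum>k\<le>D. f k y)" unfolding S_def by blast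
    show "mvec (adjm (R 1)) v \<in> S"
      unfolding f(2) mvec_sum using SA f(1) by (intro csub_sum[OF S]) auto
    show "(\<lambda>y. E 1 x y * v y) \<in> S"
      unfolding f(2) sum_distrib_left using SD f(1) by (intro csub_sum[OF S]) auto
  qed
  have SN: "S \<subseteq> N"
  proof
    fix v assume "v \<in> S"
    then obtain f where f: "\<forall>k\<le>D. f k \<in> U k" "v = (\<lambda>y. \<Sum>k\<le>D. f k y)" unfolding S_def by blast
    then show "v \<in> N" unfolding f(2) by (intro csub_sum[OF N]) (auto simp: U_def)
  qed
  have \<delta>D: "\<delta> \<le> D" using \<delta>t by simp
  have "mvec (E j) w = zero_vec" if "j \<le> D" "\<delta> < j" for j
    using mvec_E_E[OF that(1) \<delta>D, of w] that Ew by simp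
  then have "w \<in> U \<delta>" using w van c by (simp add: U_def)
  then have "w \<in> S" using US \<delta>D by blast
  then have "S = N" using irr TS SN wn unfolding irred_Tmodule_def by blast
  define r where "r = endpoint D R x N"
  define s where "s = dual_endpoint D E N"
  have dual_idem: "mvec (dual_idem R i x) v = (\<lambda>y. if dst x y = i then v y else 0)" if "i \<le> D" for i v
    using that by (simp add: dual_idem_def mvec_diagm adjm_R fun_eq_iff)
  have "\<exists>i. i \<le> D \<and> (\<exists>w\<in>N. mvec (dual_idem R i x) w \<noteq> zero_vec)"
  proof -
    obtain y where y: "w y \<noteq> 0" using wn by (auto simp: Defs.zero_vec_def)
    then have "mvec (dual_idem R (dst x y) x) w \<noteq> zero_vec"
      unfolding dual_idem[OF dst_le] by (auto simp: Defs.zero_vec_def fun_eq_iff)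
    then show ?thesis using w dst_le by blast
  qed
  from LeastI_ex[OF this] obtain n where r: "r \<le> D" "n \<in> N" "mvec (dual_idem R r x) n \<noteq> zero_vec"
    unfolding r_def endpoint_def by blast
  obtain y where y: "dst x y = r" "n y \<noteq> 0"
    using r(3) unfolding dual_idem[OF r(1)] by (auto simp: Defs.zero_vec_def fun_eq_iff split: if_splits)
  have low: "mvec (E j) v = zero_vec" if "j < s" "j \<le> D" "v \<in> N" for j v
    using not_less_Least[of j "\<lambda>j. j \<le> D \<and> (\<exists>w\<in>N. mvec (E j) w \<noteq> zero_vec)"] that
    unfolding s_def dual_endpoint_def by blast
  obtain f where f: "\<forall>k\<le>D. f k \<in> U k" "n = (\<lambda>y. \<Sum>k\<le>D. f k y)"
    using r(2) \<open>S = N\<close> unfolding S_def by blast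
  \<comment> \<open>Below the dual endpoint the summand is zero because no spectral component is
    available. From the dual endpoint on, \<open>k + c\<close> exceeds \<open>k\<close>, which is at
    least the endpoint \<open>r\<close>, so all vectors in the summand vanish at distance
    \<open>r\<close>.\<close>
  have "f k y = 0" if k: "k \<le> D" for k
  proof (cases "k < s")
    case True
    have "f k = zero_vec"
    proof (rule zero_if_all_components_zero)
      fix j assume j: "j \<le> D"
      show "mvec (E j) (f k) = zero_vec"
        using f(1) k j low[of j "f k"] True by (cases "k < j") (auto simp: U_def)
    qed
    then show ?thesis by (simp add: Defs.zero_vec_def)
  next
    case False
    then have "dst x y < k + c" using ep y(1) c unfolding r_def s_def by linarith
    then show ?thesis using f(1) k by (auto simp: U_def)
  qed
  then show False using y(2) unfolding f(2) by simp
qed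

text \<open>A submodule of least dimension that is not orthogonal to \<open>u\<close> is irreducible.\<close>

lemma module_vanish:
  assumes Eu: "mvec (E \<delta>) u = u" and van: "\<And>y. dst x y \<le> t \<Longrightarrow> u y = 0"
    and orth: "\<And>i. (\<Sum>y | dst x y = i. u y) = 0"
    and \<delta>t: "\<delta> \<le> t" "t \<le> D"
    and modules: "\<And>W. irred_Tmodule D R E x W \<Longrightarrow> 1 \<le> dual_endpoint D E W \<Longrightarrow>
        dual_endpoint D E W \<le> \<delta> \<Longrightarrow> endpoint D R x W \<le> dual_endpoint D E W"
  shows "u = zero_vec"
proof (rule ccontr)
  assume un: "u \<noteq> zero_vec"
  have one: "1 \<le> D" and \<delta>D: "\<delta> \<le> D" using D3 \<delta>t by auto
  have A1: "adjm (R 1) \<in> BM D R" unfolding BM_iff using D3 by (simp add: adjm_R)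
  have A1_entry: "adjm (R 1) y z = (if dst y z = 1 then 1 else 0)" for y z
    by (rule adjm_R) (use D3 in simp)
  have h: "\<exists>h. \<forall>y. E 1 x y = h (dst x y)"
    using BM_fun[OF E_BM[OF one]] by metis
  \<comment> \<open>The orthogonal complement of the primary module, which consists of the vectors
    constant on each sphere around \<open>x\<close>.\<close>
  define V where "V = {v :: 'a cvec. \<forall>i. (\<Sum>y | dst x y = i. v y) = 0}"
  have V: "csubspace V"
    by (auto simp: csubspace_def V_def Defs.zero_vec_def sum.distrib sum_distrib_left[symmetric])
  have VT: "Tmodule D R E x V"
  proof (rule Tmodule_generators[OF V])
    fix v assume v: "v \<in> V"
    show "(\<lambda>y. E 1 x y * v y) \<in> V"
    proof -
      obtain h where h: "\<And>y. E 1 x y = h (dst x y)" using h by blast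
      have "(\<Sum>y | dst x y = i. E 1 x y * v y) = h i * (\<Sum>y | dst x y = i. v y)" for i
        unfolding sum_distrib_left by (intro sum.cong refl) (simp add: h[simplified])
      then show ?thesis using v by (simp add: V_def)
    qed
    show "mvec (adjm (R 1)) v \<in> V"
    proof -
      have "(\<Sum>y | dst x y = i. mvec (adjm (R 1)) v y) = 0" for i
      proof -
        \<comment> \<open>The number of neighbours of \<open>z\<close> on a sphere depends only on
          the distance of \<open>z\<close>; one representative per distance lets this number leave
          the inner sum.\<close>
        define g where "g k = (SOME z. dst x z = k)" for k
        have g: "dst x (g (dst x z)) = dst x z" for z unfolding g_def by (rule someI) simp
        have "(\<Sum>y | dst x y = i. mvec (adjm (R 1)) v y)
            = (\<Sum>y\<in>UNIV. \<Sum>z\<in>UNIV. (if dst x y = i \<and> dst y z = 1 then 1 else 0) * v z)"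
        proof -
          have "(\<Sum>y | dst x y = i. mvec (adjm (R 1)) v y)
              = (\<Sum>y\<in>UNIV. if dst x y = i then mvec (adjm (R 1)) v y else 0)"
            by (simp add: sum.If_cases)
          also have "\<dots> = (\<Sum>y\<in>UNIV. \<Sum>z\<in>UNIV. (if dst x y = i \<and> dst y z = 1 then 1 else 0) * v z)"
            by (intro sum.cong refl) (auto simp: mvec_def A1_entry[simplified] intro!: sum.cong)
          finally show ?thesis .
        qed
        also have "\<dots> = (\<Sum>z\<in>UNIV. \<Sum>y\<in>UNIV. (if dst x y = i \<and> dst y z = 1 then 1 else 0) * v z)"
          by (rule sum.swap)
        also have "\<dots> = (\<Sum>z\<in>UNIV. of_nat (card {y. dst x y = i \<and> dst y z = 1}) * v z)"
          by (simp add: sum_distrib_right[symmetric] sum.If_cases)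
        also have "\<dots> = (\<Sum>z\<in>UNIV. of_nat (card {y. dst x y = i \<and> dst y (g (dst x z)) = 1}) * v z)"
          by (intro sum.cong refl arg_cong2[of _ _ _ _ "(*)"] arg_cong[of _ _ of_nat]
              card_transport g[symmetric])
        also have "\<dots> = (\<Sum>k\<le>D. \<Sum>z | z \<in> UNIV \<and> dst x z = k.
            of_nat (card {y. dst x y = i \<and> dst y (g (dst x z)) = 1}) * v z)"
          by (rule sum.group[symmetric]) auto
        also have "\<dots> = (\<Sum>k\<le>D. of_nat (card {y. dst x y = i \<and> dst y (g k) = 1}) * (\<Sum>z | dst x z = k. v z))"
          unfolding sum_distrib_left by (intro sum.cong) auto
        also have "\<dots> = 0" using v by (simp add: V_def)
        finally show ?thesis .
      qed
      then show ?thesis by (simp add: V_def)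
    qed
  qed
  define P where "P N \<longleftrightarrow> Tmodule D R E x N \<and> N \<subseteq> V \<and> (\<exists>n\<in>N. ip u n \<noteq> 0)" for N
  have "P V"
    using VT orth un ip_self[of u] by (auto simp: P_def V_def)
  then obtain N where PN: "P N" and min: "\<And>N'. P N' \<Longrightarrow> rdim N \<le> rdim N'"
    using ex_has_least_nat[of P V rdim] by blast
  have T: "Tmodule D R E x N" and NV: "N \<subseteq> V" and ex: "\<exists>n\<in>N. ip u n \<noteq> 0"
    using PN by (auto simp: P_def)
  note N = Tmodule_csubspace[OF T]
  have small: "ip u n = 0" if "Tmodule D R E x W" "W \<subset> N" "n \<in> W" for W n
  proof (rule ccontr)
    assume "ip u n \<noteq> 0"
    then have "P W" using that NV by (auto simp: P_def)
    then show False
      using min[of W] rdim_psubset[OF Tmodule_csubspace[OF that(1)] N that(2)] by simp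
  qed
  have irr: "irred_Tmodule D R E x N"
    unfolding irred_Tmodule_def
  proof (intro conjI allI impI T)
    show "N \<noteq> {zero_vec}" using ex by (auto simp: ip_def Defs.zero_vec_def)
    fix W assume W: "Tmodule D R E x W \<and> W \<subseteq> N"
    show "W = {zero_vec} \<or> W = N"
    proof (rule ccontr)
      assume n: "\<not> (W = {zero_vec} \<or> W = N)"
      note WT = conjunct1[OF W]
      note Wc = Tmodule_csubspace[OF WT]
      \<comment> \<open>The complement of \<open>W\<close> in \<open>N\<close> is a submodule
        because both generators are real and symmetric. By minimality \<open>u\<close> is orthogonal
        to \<open>W\<close> and to \<open>C\<close>, hence to all of \<open>N\<close>.\<close>
      define C where "C = {n \<in> N. \<forall>m\<in>W. ip n m = 0}"
      have C: "csubspace C"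
        unfolding csubspace_def C_def using csub_zero[OF N] csub_add[OF N] csub_scale[OF N]
        by (auto simp: ip_def Defs.zero_vec_def sum.distrib distrib_right sum_distrib_left[symmetric] mult.assoc)
      have "Tmodule D R E x C"
      proof (rule Tmodule_generators[OF C])
        fix v assume v: "v \<in> C"
        have "ip (mvec (adjm (R 1)) v) m = ip v (mvec (adjm (R 1)) m)" for m
          by (rule ip_BM[OF BM_sym[OF A1]]) (simp add: adjm_def)
        then show "mvec (adjm (R 1)) v \<in> C"
          using v Tmodule_BM[OF T A1] Tmodule_BM[OF WT A1] by (simp add: C_def)
        obtain h where h: "\<And>y. E 1 x y = h (dst x y)" using h by blast
        have "ip (\<lambda>y. E 1 x y * v y) m = ip v (\<lambda>y. E 1 x y * m y)" for m
          unfolding ip_def complex_cnj_mult E_real[OF one] by (simp add: mult.commute mult.left_commute)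
        then show "(\<lambda>y. E 1 x y * v y) \<in> C"
          using v Tmodule_diag[OF T, of v h] Tmodule_diag[OF WT, of _ h]
          unfolding h C_def by simp
      qed
      moreover have "C \<subset> N"
      proof -
        obtain m where m: "m \<in> W" "m \<noteq> zero_vec" using n csub_zero[OF Wc] by blast
        then have "m \<notin> C" using ip_self[of m] by (auto simp: C_def)
        then show ?thesis using m W by (auto simp: C_def)
      qed
      ultimately have uC: "ip u v = 0" if "v \<in> C" for v using small that by blast
      have "W \<subset> N" using W n by blast
      then have uW: "ip u v = 0" if "v \<in> W" for v using small WT that by blast
      obtain v where v: "v \<in> N" "ip u v \<noteq> 0" using ex by blast
      obtain w where w: "w \<in> W" "\<And>m. m \<in> W \<Longrightarrow> ip (\<lambda>y. v y - w y) m = 0"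
        using orthogonal_decomposition[OF Wc, of v] by blast
      have "(\<lambda>y. v y - w y) \<in> C"
        using w W v csub_diff[OF N, of v w] by (auto simp: C_def)
      then have "ip u (\<lambda>y. w y + (v y - w y)) = 0"
        unfolding ip_add_right using uC uW w by simp
      then show False using v by simp
    qed
  qed
  obtain w where w: "w \<in> N" "\<And>m. m \<in> N \<Longrightarrow> ip (\<lambda>y. u y - w y) m = 0"
    using orthogonal_decomposition[OF N, of u] by blast
  have wn: "w \<noteq> zero_vec"
  proof
    assume "w = zero_vec"
    then have "ip u m = 0" if "m \<in> N" for m using w(2)[OF that] by (simp add: Defs.zero_vec_def)
    then show False using ex by blast
  qed
  have Ew: "mvec (E \<delta>) w = w"
  proof -
    \<comment> \<open>The defect of \<open>w\<close> lies in \<open>N\<close>, and self-adjointness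
      moves \<open>E \<delta>\<close> onto \<open>u\<close>, where it acts trivially; the defect is
      therefore orthogonal to itself.\<close>
    define v where "v = (\<lambda>y. mvec (E \<delta>) w y - w y)"
    have vN: "v \<in> N" unfolding v_def by (intro csub_diff[OF N] Tmodule_BM[OF T E_BM[OF \<delta>D]] w)
    have "ip (mvec (E \<delta>) (\<lambda>y. u y - w y)) v = ip (\<lambda>y. u y - w y) (mvec (E \<delta>) v)"
      by (rule ip_BM[OF E_sym[OF \<delta>D] E_real[OF \<delta>D]])
    then have "ip (\<lambda>y. u y - w y) v - ip (mvec (E \<delta>) (\<lambda>y. u y - w y)) v = 0"
      using w(2)[OF vN] w(2)[OF Tmodule_BM[OF T E_BM[OF \<delta>D] vN]] by simp
    then have "ip v v = 0"
      unfolding mvec_diff Eu by (simp add: ip_def v_def sum_subtractf[symmetric] algebra_simps)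
    then have "v = zero_vec" by (rule ip_self)
    then show ?thesis by (simp add: v_def Defs.zero_vec_def fun_eq_iff)
  qed
  have w0: "w y = 0" if y: "dst x y \<le> t" for y
  proof -
    \<comment> \<open>The restriction of \<open>w\<close> to the ball of radius \<open>t\<close>
      stays in \<open>N\<close>. Since \<open>u\<close> vanishes on the ball, orthogonality of
      \<open>u - w\<close> to \<open>N\<close> makes the norm of the restriction zero.\<close>
    define v where "v = (\<lambda>y. (\<lambda>i. if i \<le> t then 1 else 0) (dst x y) * w y)"
    have vN: "v \<in> N" unfolding v_def by (rule Tmodule_diag[OF T w(1)])
    have "ip v v = - ip (\<lambda>y. u y - w y) v"
      unfolding ip_def sum_negf[symmetric]
      by (intro sum.cong refl) (simp add: v_def van)
    then have "ip v v = 0" using w(2)[OF vN] by simp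
    then have "v = zero_vec" by (rule ip_self)
    then have "v y = 0" by (simp add: Defs.zero_vec_def)
    then show ?thesis using y by (simp add: v_def)
  qed
  have le: "dual_endpoint D E N \<le> \<delta>"
    unfolding dual_endpoint_def by (rule Least_le) (use \<delta>D w Ew wn in auto)
  \<comment> \<open>Sphere sums in \<open>N\<close> are zero, so total sums are too, and
    \<open>E 0\<close> annihilates \<open>N\<close>. This supplies the lower bound needed for the
    hypothesis on endpoints.\<close>
  have "dual_endpoint D E N \<noteq> 0"
  proof
    assume 0: "dual_endpoint D E N = 0"
    have "\<exists>j. j \<le> D \<and> (\<exists>w\<in>N. mvec (E j) w \<noteq> zero_vec)"
      using \<delta>D w(1) Ew wn by (intro exI[of _ \<delta>]) auto
    from LeastI_ex[OF this] 0 obtain m where m: "m \<in> N" "mvec (E 0) m \<noteq> zero_vec"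
      unfolding dual_endpoint_def by auto
    have "(\<Sum>z\<in>UNIV. m z) = (\<Sum>k\<le>D. \<Sum>z | z \<in> UNIV \<and> dst x z = k. m z)"
      by (rule sum.group[symmetric]) auto
    also have "\<dots> = 0" using m NV by (auto simp: V_def)
    finally have "mvec (E 0) m = zero_vec"
      by (simp add: mvec_def E_0 Defs.zero_vec_def sum_divide_distrib[symmetric])
    then show False using m by blast
  qed
  then have "endpoint D R x N \<le> dual_endpoint D E N" using modules[OF irr] le by simp
  from split_vanish[OF irr w(1) Ew w0 \<delta>t this] show False using wn by blast
qed

subsection \<open>Columns of a primitive idempotent\<close>

text \<open>Otherwise adjacent vertices have equal columns, and connectedness makes every row
  constant, against orthogonality to \<open>E 0\<close>.\<close>

lemma neighbour_value_neq:
  assumes j: "1 \<le> j" "j \<le> D" and xz: "dst x z = 1"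
  shows "E j x z \<noteq> E j x x"
proof
  assume eq: "E j x z = E j x x"
  have step: "E j w u = E j w v" if uv: "dst u v = 1" for u v w
  proof -
    have "E j u v = 1 * E j u u"
      using E_cong[OF j(2), of u v x z] uv xz eq E_diag_const[OF j(2), of u x] by simp
    from E_column[OF j(2) _ this, of w] show ?thesis by simp
  qed
  have const: "E j x u = E j x x" for u
    by (rule connected_induct[of "\<lambda>u. E j x u = E j x x" x]) (use step[of _ _ x] in auto)
  have "0 = (\<Sum>u\<in>UNIV. E j x u * E 0 u x)" using E_mult[OF j(2), of 0 x x] j by simp
  also have "\<dots> = (\<Sum>u\<in>(UNIV :: 'a set). E j x x / of_nat CARD('a))"
  proof (rule sum.cong[OF refl])
    fix u
    show "E j x u * E 0 u x = E j x x / of_nat CARD('a)"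
      unfolding E_0 using const[of u] by simp
  qed
  also have "\<dots> = E j x x" by simp
  finally show False using E_diag_nonzero[OF j(2)] by metis
qed

lemma columns_eqI:
  assumes "j \<le> D" "E j x y = E j x x"
  shows "E j w x = E j w y"
  using E_column[OF assms(1), of 1 x y w] assms(2) by simp

lemma columns_eq_transport:
  assumes j: "j \<le> D" and xy: "\<And>w. E j w x = E j w y" and d: "dst a b = dst x y"
  shows "E j w a = E j w b"
proof (rule columns_eqI[OF j])
  show "E j a b = E j a a"
    using E_cong[OF j d] xy[of x] E_diag_const[OF j, of a x] by simp
qed

lemma columns_eq_not_adjacent:
  assumes j: "1 \<le> j" "j \<le> D" and xy: "\<And>w. E j w x = E j w y"
  shows "dst x y \<noteq> 1"
  using neighbour_value_neq[OF j, of x y] xy[of x] by auto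

text \<open>All points at distance \<open>i\<close> from a common point have the same column. Hence
  no neighbour of \<open>x\<close> is at distance \<open>i\<close> from \<open>y\<close>, and two of
  the three neighbours are both at distance \<open>i - 1\<close> or both at \<open>i + 1\<close>.
  Moving \<open>y\<close> one step away from \<open>x\<close>, respectively towards
  \<open>x\<close>, gives a point \<open>c\<close> at distance \<open>i\<close> from both. Equal
  columns exclude adjacency, so the two are at distance two.\<close>

lemma distance_two_columns_eq:
  assumes j: "1 \<le> j" "j \<le> D" and xy: "dst x y = i" and i: "1 \<le> i" "i < D"
    and s: "s = 1 \<or> s = -1" and e: "E j x y = s * E j x x"
    and deg: "3 \<le> card {z. dst x z = 1}"
  shows "\<exists>u v. dst u v = 2 \<and> (\<forall>w. E j w u = E j w v)"
proof -
  have col: "E j w p = E j w q" if "dst c p = i" "dst c q = i" for c p q w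
  proof -
    have "E j w p = s * E j w c" if "dst c p = i" for p
    proof (rule E_column[OF j(2) s])
      show "E j p c = s * E j p p"
        using E_cong[OF j(2), of p c x y] that xy e E_diag_const[OF j(2), of p x]
        by (simp add: dst_sym)
    qed
    then show ?thesis using that by simp
  qed
  define A where "A = {z. dst x z = 1 \<and> Suc (dst y z) = i}"
  define B where "B = {z. dst x z = 1 \<and> dst y z = Suc i}"
  have "{z. dst x z = 1} = A \<union> B"
  proof -
    have "dst y z \<noteq> i" if "dst x z = 1" for z
      using columns_eq_not_adjacent[OF j, of x z] col[of y x z] xy that by (auto simp: dst_sym)
    then show ?thesis
      using neighbour_cases[of y x i] xy unfolding A_def B_def by (auto simp: dst_sym)
  qed
  then have "3 \<le> card A + card B" using deg card_Un_le[of A B] by simp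
  then have "2 \<le> card A \<or> 2 \<le> card B" by linarith
  then obtain z1 z2 c where z: "z1 \<noteq> z2" "dst x z1 = 1" "dst x z2 = 1" "dst c z1 = i" "dst c z2 = i"
  proof
    assume "2 \<le> card A"
    then obtain z1 z2 where zz: "z1 \<in> A" "z2 \<in> A" "z1 \<noteq> z2"
      by (metis card_le_Suc0_iff_eq finite not_less_eq_eq numeral_2_eq_2)
    obtain c where c: "dst x c = Suc i" "dst c y = 1" using farther_neighbour[OF xy i(2)] by blast
    have cz: "dst c z = i" if "z \<in> A" for z
      using that dst_triangle[of c z y] dst_triangle[of x c z] c dst_sym[of z c] by (auto simp: A_def)
    show thesis
      by (rule that[of z1 z2 c]) (use zz cz in \<open>simp_all add: A_def\<close>)
  next
    assume "2 \<le> card B"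
    then obtain z1 z2 where zz: "z1 \<in> B" "z2 \<in> B" "z1 \<noteq> z2"
      by (metis card_le_Suc0_iff_eq finite not_less_eq_eq numeral_2_eq_2)
    obtain c where c: "Suc (dst x c) = i" "dst c y = 1"
      using closer_neighbour[of x y "i - 1"] xy i by force
    have cz: "dst c z = i" if "z \<in> B" for z
      using that dst_triangle[of y z c] dst_triangle[of c z x] c dst_sym[of y c] dst_sym[of x c]
      by (auto simp: B_def)
    show thesis
      by (rule that[of z1 z2 c]) (use zz cz in \<open>simp_all add: B_def\<close>)
  qed
  have eq: "E j w z1 = E j w z2" for w using col z(4,5) by blast
  have "dst z1 z2 \<noteq> 1" by (rule columns_eq_not_adjacent[OF j eq])
  moreover have "dst z1 z2 \<noteq> 0" using z(1) by simp
  moreover have "dst z1 z2 \<le> 2" using dst_triangle[of z1 z2 x] z(2,3) dst_sym[of z1 x] by simp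
  ultimately have "dst z1 z2 = 2" by linarith
  then show ?thesis using eq by blast
qed

text \<open>Triangles are impossible, so neighbours of \<open>x\<close> are pairwise at distance two
  and share one column. The eigenvalue equation then makes it a multiple \<open>m\<close> of the
  column of \<open>x\<close>; symmetry gives \<open>m * m = 1\<close>, and \<open>m = 1\<close> is
  excluded.\<close>

lemma neighbour_value_neg:
  assumes j: "1 \<le> j" "j \<le> D" and two: "\<And>u v w. dst u v = 2 \<Longrightarrow> E j w u = E j w v"
    and xz: "dst x z = 1"
  shows "E j x z = - E j x x"
proof -
  have no_triangle: False if abc: "dst a b = 1" "dst b c = 1" "dst a c = 1" for a b c
  proof -
    \<comment> \<open>A triangle provides a common neighbour \<open>w\<close> of the last two
      vertices of a geodesic of length three. According to its distance from \<open>v0\<close>, the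
      column of \<open>w\<close> equals that of \<open>v2\<close> or of \<open>v3\<close>, both
      adjacent to it.\<close>
    obtain v0 v3 where v03: "dst v0 v3 = Suc 2" using dst_attained[of 3] D3 by auto
    obtain v2 where v2: "dst v0 v2 = 2" "dst v2 v3 = 1" using closer_neighbour[OF v03] by blast
    have "dst v0 v2 = Suc 1" using v2(1) by simp
    then obtain v1 where v1: "dst v0 v1 = 1" "dst v1 v2 = 1" using closer_neighbour by blast
    obtain w where w: "dst v2 w = 1" "dst w v3 = 1"
      using ex_transport[of a c v2 v3 b 1 1] abc v2 by auto
    have v13: "dst v1 v3 = 2"
      using dst_triangle[of v1 v3 v2] dst_triangle[of v0 v3 v1] v1 v2 v03 by linarith
    have "dst v0 w \<noteq> 2"
    proof
      assume "dst v0 w = 2"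
      then have "E j q v2 = E j q w" for q using two[of v0 w q] two[OF v2(1), of q] by simp
      from columns_eq_not_adjacent[OF j this] show False using w by simp
    qed
    then have "dst v0 w = 3"
      using dst_triangle[of v0 w v2] dst_triangle[of v0 v3 w] v2 w v03 by linarith
    then have "dst v1 w = 2"
      using dst_triangle[of v0 w v1] dst_triangle[of v1 w v2] v1 w by linarith
    then have "E j q w = E j q v3" for q using two[of v1 w q] two[OF v13, of q] by simp
    from columns_eq_not_adjacent[OF j this] show False using w by simp
  qed
  have same: "E j z' w = E j z w" if z': "dst x z' = 1" for z' w
  proof -
    have "dst z' z \<noteq> 1" using no_triangle[of x z' z] z' xz by blast
    moreover have "dst z' z \<le> 2" using dst_triangle[of z' z x] z' xz dst_sym[of z' x] by simp
    ultimately have "z' = z \<or> dst z' z = 2" using dst_0[of z' z] by linarith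
    then have "E j w z' = E j w z" using two by blast
    then show ?thesis using E_sym[OF j(2)] by metis
  qed
  have A1: "adjm (R 1) \<in> BM D R" unfolding BM_iff using D3 by (simp add: adjm_R)
  obtain \<theta> where \<theta>: "\<And>j x y. j \<le> D \<Longrightarrow>
      (\<Sum>z\<in>UNIV. adjm (R 1) x z * E j z y) = \<theta> j * E j x y" using BM_eigen[OF A1] by blast
  define k where "k = (of_nat (card {z. dst x z = 1}) :: complex)"
  have k: "k \<noteq> 0" unfolding k_def using xz by auto
  have kE: "k * E j z w = \<theta> j * E j x w" for w
  proof -
    have "\<theta> j * E j x w = (\<Sum>z'\<in>UNIV. adjm (R 1) x z' * E j z' w)" using \<theta>[OF j(2)] by simp
    also have "\<dots> = (\<Sum>z'\<in>UNIV. if dst x z' = 1 then E j z w else 0)"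
    proof (rule sum.cong[OF refl])
      fix z'
      have "adjm (R 1) x z' = (if dst x z' = 1 then 1 else 0)" by (rule adjm_R) (use D3 in simp)
      then show "adjm (R 1) x z' * E j z' w = (if dst x z' = 1 then E j z w else 0)"
        using same[of z' w] by (simp only: split: if_split) simp
    qed
    also have "\<dots> = k * E j z w" by (simp add: sum.If_cases k_def)
    finally show ?thesis by simp
  qed
  define m where "m = \<theta> j / k"
  have m: "E j z w = m * E j x w" for w using kE[of w] k by (simp add: m_def field_simps)
  have xzm: "E j x z = m * E j x x" using m[of x] E_sym[OF j(2), of z x] by simp
  have "E j x x = m * (m * E j x x)"
    using m[of z] xzm E_diag_const[OF j(2), of z x] by simp
  then have "m * m = 1" using E_diag_nonzero[OF j(2), of x] by simp
  then have "m = 1 \<or> m = -1" by (simp add: square_eq_1_iff)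
  moreover have "m \<noteq> 1" using neighbour_value_neq[OF j xz] xzm by auto
  ultimately show ?thesis using xzm by simp
qed

lemma krein_commute: "krein h l i = krein h i l"
  unfolding krein_def by (intro sum.cong refl) (simp add: mult.commute mult.left_commute)

text \<open>If \<open>E\<^sub>j\<close> has rank one with entries \<open>\<plusminus>e\<close>, entrywise multiplication by \<open>E\<^sub>j / e\<close> is an
  automorphism of the Bose--Mesner algebra, so it maps \<open>E\<^sub>1\<close> to a single \<open>E\<^sub>l\<close>; but for
  \<open>j < D\<close> both \<open>E\<^sub>j\<^sub>-\<^sub>1\<close> and \<open>E\<^sub>j\<^sub>+\<^sub>1\<close> occur in the entrywise product of \<open>E\<^sub>1\<close> and \<open>E\<^sub>j\<close>.\<close>

lemma bipartite_idempotent: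
  assumes j: "1 \<le> j" "j \<le> D" and neg: "\<And>x z. dst x z = 1 \<Longrightarrow> E j x z = - E j x x"
  shows "j = D" and "dst y z = 1 \<Longrightarrow> E j z w = - E j y w" and "E j y w \<noteq> 0"
proof -
  have adj: "E j w y = - E j w z" if "dst y z = 1" for y z w
    using E_column[OF j(2), of "-1" y z w] neg[OF that] by simp
  then show "dst y z = 1 \<Longrightarrow> E j z w = - E j y w"
    using E_sym[OF j(2), of _ w] by simp
  have pm: "(\<forall>w. E j w y = E j w x) \<or> (\<forall>w. E j w y = - E j w x)" for x y
    by (rule connected_induct[of "\<lambda>y. (\<forall>w. E j w y = E j w x) \<or> (\<forall>w. E j w y = - E j w x)" x])
      (use adj in \<open>auto, metis minus_minus\<close>)
  have nz: "E j y w \<noteq> 0" for y w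
    using pm[of w y] E_diag_nonzero[OF j(2), of y] by auto
  then show "E j y w \<noteq> 0" .
  obtain e where e: "\<And>x. E j x x = e" using E_diag_const[OF j(2)] by metis
  have e0: "e \<noteq> 0" using E_diag_nonzero[OF j(2)] e by metis
  \<comment> \<open>The rank-one identity, which makes entrywise multiplication by
    \<open>E j / e\<close> compatible with the matrix product.\<close>
  have mult: "E j x z * E j z y = e * E j x y" for x y z
  proof -
    have "E j z y = E j y z" "E j x y = E j y x" by (rule E_sym[OF j(2)])+
    then show ?thesis using pm[of z x] e[of x] by auto
  qed
  define \<phi> where "\<phi> F = (\<lambda>x y. F x y * E j x y / e)" for F :: "'a cmat"
  have \<phi>BM: "\<phi> F \<in> BM D R" if "F \<in> BM D R" for F
    unfolding \<phi>_def by (rule BM_pointwise[OF that E_BM[OF j(2)]])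
  have \<phi>\<phi>: "\<phi> (\<phi> F) = F" for F
  proof (intro ext)
    fix x y
    have "E j x y * E j x y = e * e" using mult[of x y x] e[of x] E_sym[OF j(2), of x y] by simp
    then show "\<phi> (\<phi> F) x y = F x y" using e0 by (simp add: \<phi>_def mult.assoc)
  qed
  have \<phi>mult: "mmult (\<phi> F) (\<phi> G) = \<phi> (mmult F G)" for F G
  proof (intro ext)
    fix x y
    have "\<phi> F x z * \<phi> G z y = F x z * G z y * E j x y / e" for z
    proof -
      have "\<phi> F x z * \<phi> G z y = F x z * G z y * (E j x z * E j z y) / (e * e)"
        by (simp add: \<phi>_def)
      then show ?thesis unfolding mult using e0 by (simp add: field_simps)
    qed
    then show "mmult (\<phi> F) (\<phi> G) x y = \<phi> (mmult F G) x y"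
      by (simp add: mmult_def \<phi>_def sum_distrib_right sum_divide_distrib)
  qed
  have \<phi>add: "\<phi> (madd F G) = madd (\<phi> F) (\<phi> G)" for F G
    by (simp add: \<phi>_def madd_def fun_eq_iff add_divide_distrib distrib_right)
  have \<phi>0: "\<phi> F = zero_mat \<longleftrightarrow> F = zero_mat" for F
    using nz e0 by (simp add: \<phi>_def zero_mat_def fun_eq_iff)
  have one: "1 \<le> D" using D3 by simp
  have "prim_idem D R (\<phi> (E 1))"
    unfolding prim_idem_def idempotent_def
  proof (intro conjI ballI impI)
    show "\<phi> (E 1) \<in> BM D R" by (rule \<phi>BM[OF E_BM[OF one]])
    show "\<phi> (E 1) \<noteq> zero_mat" using E_nonzero[OF one] \<phi>0 by blast
    show "mmult (\<phi> (E 1)) (\<phi> (E 1)) = \<phi> (E 1)" unfolding \<phi>mult E_idem[OF one] ..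
    fix G H assume G: "G \<in> BM D R" "mmult G G = G" and H: "H \<in> BM D R" "mmult H H = H"
      and GH: "mmult G H = zero_mat" "\<phi> (E 1) = madd G H"
    have "E 1 = madd (\<phi> G) (\<phi> H)" using GH(2) \<phi>\<phi> \<phi>add by metis
    moreover have "mmult (\<phi> G) (\<phi> H) = zero_mat" unfolding \<phi>mult using GH(1) \<phi>0 by blast
    moreover have "mmult (\<phi> G) (\<phi> G) = \<phi> G" "mmult (\<phi> H) (\<phi> H) = \<phi> H"
      unfolding \<phi>mult G(2) H(2) by (rule refl)+
    ultimately have "\<phi> G = zero_mat \<or> \<phi> H = zero_mat"
      using E_prim[OF one] \<phi>BM[OF G(1)] \<phi>BM[OF H(1)]
      unfolding prim_idem_def idempotent_def by blast
    then show "G = zero_mat \<or> H = zero_mat" using \<phi>0 by blast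
  qed
  then obtain l where l: "l \<le> D" "\<phi> (E 1) = E l"
    using idem unfolding prim_idempotents_def by blast
  have prod: "E 1 x y * E j x y = (\<Sum>i\<le>D. (if i = l then e else 0) * E i x y)" for x y
  proof -
    have "(\<Sum>i\<le>D. (if i = l then e else 0) * E i x y) = (\<Sum>i\<le>D. if i = l then e * E l x y else 0)"
      by (intro sum.cong refl) auto
    also have "\<dots> = e * \<phi> (E 1) x y" using l by simp
    finally show ?thesis using e0 by (simp add: \<phi>_def)
  qed
  have kr: "krein 1 j i = 0" if "i \<le> D" "i \<noteq> l" for i
    using krein_expand[OF order_refl that(1) prod, where a = undefined] that by simp
  show "j = D"
  proof (rule ccontr)
    assume "j \<noteq> D"
    then have "Suc j \<le> D" using j by simp
    then have "l = Suc j" using krein_nonzero kr by blast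
    moreover have "krein 1 j (j - 1) \<noteq> 0"
      using krein_nonzero[of "j - 1"] j krein_commute[of 1 j "j - 1"] by simp
    then have "l = j - 1" using kr[of "j - 1"] j by (metis diff_le_self le_trans)
    ultimately show False by simp
  qed
qed

subsection \<open>The exceptional subsets\<close>

text \<open>The graph is regular. The middle of a geodesic of length two has two neighbours, and
  valency exactly two would make the connected graph a cycle.\<close>

lemma three_neighbours:
  assumes "\<not> is_cycle_graph (R 1)"
  shows "3 \<le> card {z. dst x z = 1}"
proof -
  have reg: "card {z. dst y z = 1} = card {z. dst x z = 1}" for y
  proof -
    have "{z. dst y z = 1} = {z. dst y z = 1 \<and> dst z y = 1}" for y using dst_sym by auto
    then show ?thesis using card_transport[of y y x x 1 1] by (metis dst_0)
  qed
  have "card {z. dst x z = 1} \<ge> 2"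
  proof -
    obtain a b where ab: "dst a b = Suc 1" using dst_attained[of "Suc 1"] D3 by auto
    obtain c where c: "dst a c = 1" "dst c b = 1" using closer_neighbour[OF ab] by blast
    have "a \<noteq> b" using ab by (metis dst_0 nat.distinct(1))
    then have "card {a, b} = 2" by simp
    moreover have "{a, b} \<subseteq> {z. dst c z = 1}" using c dst_sym[of c a] by auto
    ultimately have "2 \<le> card {z. dst c z = 1}" by (metis card_mono finite)
    then show ?thesis using reg by metis
  qed
  moreover have "card {z. dst x z = 1} \<noteq> 2"
  proof
    assume two: "card {z. dst x z = 1} = 2"
    have "is_cycle_graph (R 1)"
    proof (rule two_regular_connected_is_cycle)
      show "(v, u) \<in> R 1" if "(u, v) \<in> R 1" for u v
        using that unfolding R1_iff by (metis dst_sym)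
      show "(u, u) \<notin> R 1" for u unfolding R1_iff using dst_0[of u u] by simp
      show "card {y. (u, y) \<in> R 1} = 2" for u unfolding R1_iff using reg[of u] two by simp
      show "(u, v) \<in> (R 1)\<^sup>*" for u v by (rule relpow_imp_rtrancl[OF dst_relpow])
    qed
    then show False using assms by blast
  qed
  ultimately show ?thesis by linarith
qed

section \<open>The characteristic vector and its spectral components\<close>

lemma mvec_charv: "mvec M (charv Y) w = (\<Sum>y\<in>Y. M w y)" for M :: "'a cmat"
proof -
  have "mvec M (charv Y) w = (\<Sum>y\<in>UNIV. if y \<in> Y then M w y else 0)"
    unfolding mvec_def charv_def by (intro sum.cong refl) simp
  then show ?thesis by (simp add: sum.If_cases)
qed

lemma delta_star_props:
  assumes Y: "Y \<noteq> {}" "Y \<noteq> UNIV"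
  shows "1 \<le> delta_star D E Y" "delta_star D E Y \<le> D"
    "mvec (E (delta_star D E Y)) (charv Y) \<noteq> zero_vec"
    "1 \<le> j \<Longrightarrow> j < delta_star D E Y \<Longrightarrow> mvec (E j) (charv Y) = zero_vec"
proof -
  let ?P = "\<lambda>j. j \<noteq> 0 \<and> j \<le> D \<and> mvec (E j) (charv Y) \<noteq> zero_vec"
  \<comment> \<open>The minimum is over a nonempty set: with only the \<open>E 0\<close> component
    left, \<open>charv Y\<close> would be constant, contrary to \<open>Y\<close> being proper and
    nonempty.\<close>
  have "\<exists>j. ?P j"
  proof (rule ccontr)
    assume n: "\<nexists>j. ?P j"
    have "charv Y y = mvec (E 0) (charv Y) y" for y
    proof -
      have "charv Y y = (\<Sum>j\<le>D. mvec (E j) (charv Y) y)" by (rule sum_mvec_E[symmetric])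
      also have "\<dots> = (\<Sum>j\<le>D. if j = 0 then mvec (E 0) (charv Y) y else 0)"
        using n by (intro sum.cong refl) (auto simp: Defs.zero_vec_def)
      finally show ?thesis by simp
    qed
    then have eq: "charv Y y = charv Y z" for y z by (simp add: mvec_charv E_0)
    obtain a b where "a \<in> Y" "b \<notin> Y" using Y by blast
    then show False using eq[of a b] by (simp add: charv_def)
  qed
  from LeastI_ex[OF this] show 1: "1 \<le> delta_star D E Y" and D: "delta_star D E Y \<le> D"
    and "mvec (E (delta_star D E Y)) (charv Y) \<noteq> zero_vec"
    unfolding delta_star_def[symmetric] by auto
  show "mvec (E j) (charv Y) = zero_vec" if "1 \<le> j" "j < delta_star D E Y"
    using not_less_Least[of j ?P] that D unfolding delta_star_def by auto
qed

text \<open>Dependence on the indicator of a sphere means being constant on that sphere; this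
  extends linearly from the associate matrices to the whole algebra. The sphere of radius 0, which
  the codesign condition omits, is a single point.\<close>

lemma codesign_constant:
  assumes t: "t \<le> D" and cd: "\<forall>l\<le>D. rel_codesign R x t (mvec (adjm (R l)) \<psi>)"
    and M: "M \<in> BM D R" and d: "dst x y = dst x z" "dst x y \<le> t"
  shows "mvec M \<psi> y = mvec M \<psi> z"
proof (cases "dst x y = 0")
  case True
  then show ?thesis using d(1) by (metis dst_0)
next
  case False
  define i where "i = dst x y"
  have i: "1 \<le> i" "i \<le> t" "i \<le> D" using False d t unfolding i_def by linarith+
  have const: "mvec (adjm (R l)) \<psi> y = mvec (adjm (R l)) \<psi> z" if l: "l \<le> D" for l
  proof -
    have "lin_dep2 (mvec (dual_idem R i x) (mvec (adjm (R l)) \<psi>)) (mvec (adjm (R i)) (basisv x))"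
      using cd l i unfolding rel_codesign_def by blast
    then obtain a b where ab: "a \<noteq> 0 \<or> b \<noteq> 0"
      and lin: "\<And>w. a * mvec (dual_idem R i x) (mvec (adjm (R l)) \<psi>) w + b * mvec (adjm (R i)) (basisv x) w = 0"
      unfolding lin_dep2_def by blast
    have "a * mvec (adjm (R l)) \<psi> w + b = 0" if w: "dst x w = i" for w
    proof -
      have "mvec (dual_idem R i x) (mvec (adjm (R l)) \<psi>) w = mvec (adjm (R l)) \<psi> w"
        using w i by (simp add: dual_idem_def mvec_diagm adjm_R)
      moreover have "mvec (adjm (R i)) (basisv x) w = 1"
      proof -
        have "mvec (adjm (R i)) (basisv x) w = (\<Sum>u\<in>UNIV. if u = x then adjm (R i) w x else 0)"
          unfolding mvec_def basisv_def by (intro sum.cong refl) auto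
        then show ?thesis using w i by (simp add: adjm_R dst_sym)
      qed
      ultimately show ?thesis using lin[of w] by simp
    qed
    from this[of y] this[of z] have "a * mvec (adjm (R l)) \<psi> y + b = 0" "a * mvec (adjm (R l)) \<psi> z + b = 0"
      using d by (auto simp: i_def)
    \<comment> \<open>Here \<open>a = 0\<close> would force \<open>b = 0\<close>, so one can divide
      by \<open>a\<close>.\<close>
    then show ?thesis using ab
      by (metis add.right_cancel mult_cancel_left add_0 mult_zero_left)
  qed
  obtain c where "M = (\<lambda>x y. \<Sum>i\<le>D. c i * adjm (R i) x y)" using M by (auto simp: BM_def)
  then show ?thesis using const by (simp add: mvec_adjm_sum)
qed

lemma projection_in_line:
  assumes Y: "Y \<noteq> {}" "Y \<noteq> UNIV" and x: "x \<in> Y" and t: "delta_star D E Y \<le> t" "t \<le> D"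
    and cd: "\<forall>l\<le>D. rel_codesign R x t (mvec (adjm (R l)) (charv Y))"
    and modules: "\<And>W. irred_Tmodule D R E x W \<Longrightarrow> 1 \<le> dual_endpoint D E W \<Longrightarrow>
        dual_endpoint D E W \<le> delta_star D E Y \<Longrightarrow> endpoint D R x W \<le> dual_endpoint D E W"
  shows "\<exists>c. \<forall>y. mvec (E (delta_star D E Y)) (charv Y) y = c * E (delta_star D E Y) y x"
proof -
  define \<delta> where "\<delta> = delta_star D E Y"
  have \<delta>: "\<delta> \<le> D" using delta_star_props(2)[OF Y] by (simp add: \<delta>_def)
  \<comment> \<open>Chosen so that \<open>u\<close> vanishes at \<open>x\<close>. A sphere sum of
    \<open>u\<close> is the entry at \<open>x\<close> of an associate matrix applied to the
    eigenvector \<open>u\<close>, hence a multiple of \<open>u x\<close>.\<close>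
  define c where "c = mvec (E \<delta>) (charv Y) x / E \<delta> x x"
  define u where "u = (\<lambda>y. mvec (E \<delta>) (charv Y) y - c * E \<delta> y x)"
  have ux: "u x = 0" using E_diag_nonzero[OF \<delta>, of x] by (simp add: u_def c_def)
  have "mvec (E \<delta>) (\<lambda>y. E \<delta> y x) = (\<lambda>y. E \<delta> y x)"
    using E_mult[OF \<delta> \<delta>] by (simp add: mvec_def)
  then have Eu: "mvec (E \<delta>) u = u"
    unfolding u_def mvec_diff mvec_scale mvec_E_E[OF \<delta> \<delta>] by simp
  have orth: "(\<Sum>y | dst x y = i. u y) = 0" for i
  proof -
    define A where "A = (\<lambda>x y. if dst x y = i then 1 else 0 :: complex)"
    have A: "A \<in> BM D R" unfolding A_def by (rule BM_dst)
    obtain \<theta> where \<theta>: "\<And>j x y. j \<le> D \<Longrightarrow> (\<Sum>z\<in>UNIV. A x z * E j z y) = \<theta> j * E j x y"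
      using BM_eigen[OF A] by blast
    have "(\<Sum>y | dst x y = i. u y) = mvec A u x"
    proof -
      have "mvec A u x = (\<Sum>y\<in>UNIV. if dst x y = i then u y else 0)"
        unfolding mvec_def A_def by (intro sum.cong refl) simp
      then show ?thesis by (simp add: sum.If_cases)
    qed
    also have "\<dots> = mvec (mmult A (E \<delta>)) u x" by (simp add: mvec_mmult Eu)
    also have "\<dots> = \<theta> \<delta> * mvec (E \<delta>) u x"
      by (simp add: mmult_def mvec_def \<theta>[OF \<delta>] sum_distrib_left mult.assoc)
    also have "\<dots> = 0" by (simp add: Eu ux)
    finally show ?thesis .
  qed
  have const: "u y = u z" if "dst x y = dst x z" "dst x y \<le> t" for y z
    using codesign_constant[OF t(2) cd E_BM[OF \<delta>] that] E_cong[OF \<delta>, of y x z x] that(1)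
    by (simp add: u_def dst_sym)
  have van: "u y = 0" if y: "dst x y \<le> t" for y
  proof -
    have "0 = (\<Sum>z | dst x z = dst x y. u z)" using orth by simp
    also have "\<dots> = (\<Sum>z | dst x z = dst x y. u y)"
      by (intro sum.cong refl const) (use y in auto)
    also have "\<dots> = of_nat (card {z. dst x z = dst x y}) * u y" by simp
    finally have "of_nat (card {z. dst x z = dst x y}) * u y = 0" by simp
    moreover have "card {z. dst x z = dst x y} \<noteq> 0" by auto
    ultimately show ?thesis by simp
  qed
  have "u = zero_vec"
    by (rule module_vanish[OF Eu van orth _ t(2)]) (use t modules in \<open>simp_all add: \<delta>_def\<close>)
  then have "\<forall>y. mvec (E \<delta>) (charv Y) y = c * E \<delta> y x"
    by (simp add: u_def Defs.zero_vec_def fun_eq_iff)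
  then show ?thesis unfolding \<delta>_def by blast
qed

text \<open>The sign relation carries over to all pairs at distance \<open>D\<close>. Two points at
  distance \<open>D\<close> from the same point then have equal columns in \<open>E 1\<close>, so
  they coincide by \<open>E1_inj\<close>: antipodes are unique.\<close>

lemma antipodal_double_coverI:
  assumes "dst x y = D" "E 1 x y = - E 1 x x"
  shows "antipodal_double_cover D R"
proof -
  have one: "1 \<le> D" using D3 by simp
  have uniq: "b = c" if "dst a b = D" "dst a c = D" for a b c
  proof -
    have "E 1 w a = - 1 * E 1 w b" if "dst a b = D" for b w
      using E_column[OF one, of "-1" a b w] E_cong[OF one, of a b x y] that assms
        E_diag_const[OF one, of a x] by simp
    from this[OF that(1), of b] this[OF that(2), of b] have "E 1 b b = E 1 b c" by simp
    from E1_inj[OF this] show ?thesis by (metis dst_0)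
  qed
  have eq: "{z. a = z \<or> (a, z) \<in> R D} = {z. z = a \<or> dst a z = D}" for a using R_iff[of D a] by auto
  have "card {z. a = z \<or> (a, z) \<in> R D} = 2" for a
  proof -
    obtain b where b: "dst a b = D" using ex_at_dst[of D a] by auto
    then have "a \<noteq> b" using D3 by (metis dst_0 not_numeral_le_zero)
    moreover have "{z. z = a \<or> dst a z = D} = {a, b}" using uniq b by blast
    ultimately show ?thesis unfolding eq by simp
  qed
  moreover have "equiv UNIV {(y, z). y = z \<or> (y, z) \<in> R D}"
  proof (rule equivI)
    show "{(y, z). y = z \<or> (y, z) \<in> R D} \<subseteq> UNIV \<times> UNIV" by simp
    show "refl {(y, z). y = z \<or> (y, z) \<in> R D}" by (simp add: refl_on_def)
    show "sym {(y, z). y = z \<or> (y, z) \<in> R D}"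
      unfolding sym_def R_iff[OF order_refl] by (auto simp: R_iff dst_sym)
    show "trans {(y, z). y = z \<or> (y, z) \<in> R D}"
      unfolding trans_def using uniq by (auto simp: R_iff) (metis dst_sym)
  qed
  ultimately show ?thesis by (simp add: antipodal_double_cover_def)
qed

text \<open>Summing \<open>E\<^sub>2 = \<alpha> E\<^sub>1\<^sup>2 + \<beta> E\<^sub>1 + \<gamma>\<close> over \<open>Y\<close>, in the row of \<open>x \<in> Y\<close> and in the row of a
  neighbour \<open>v\<close> of \<open>x\<close>, yields two relations between the dual eigenvalues at distances
  \<open>0, D\<close> and \<open>1, D - 1\<close> that are incompatible when \<open>|Y| \<ge> 3\<close>.\<close>

lemma no_large_antipodal_set:
  assumes Y3: "3 \<le> card Y" and x: "x \<in> Y"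
    and pair: "\<And>y. y \<in> Y \<Longrightarrow> y \<noteq> x \<Longrightarrow> dst x y = D"
    and xv: "dst x v = 1" and vpair: "\<And>y. y \<in> Y \<Longrightarrow> y \<noteq> x \<Longrightarrow> Suc (dst v y) = D"
    and E1: "mvec (E 1) (charv Y) = zero_vec"
    and E2: "mvec (E 2) (charv Y) = zero_vec \<or> (\<forall>y\<in>Y. \<forall>w. E 2 w x = E 2 w y)"
  shows False
proof -
  have D: "1 \<le> D" "2 \<le> D" using D3 by auto
  obtain y where y: "y \<in> Y" "y \<noteq> x"
    using Y3 card_mono[of "{x}" Y] by fastforce
  have xy: "dst x y = D" and vy: "Suc (dst v y) = D" using pair vpair y by auto
  define m where "m = (of_nat (card Y - 1) :: complex)"
  have sums: "(\<Sum>z\<in>Y. M x z) = M x x + m * M x y" "(\<Sum>z\<in>Y. M v z) = M v x + m * M v y"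
    if M: "M \<in> BM D R" for M
  proof -
    have "(\<Sum>z\<in>Y. M w z) = M w x + m * M w y"
      if "\<And>z. z \<in> Y \<Longrightarrow> z \<noteq> x \<Longrightarrow> M w z = M w y" for w
    proof -
      have "(\<Sum>z\<in>Y. M w z) = M w x + (\<Sum>z\<in>Y - {x}. M w z)"
        using x by (simp add: sum.remove)
      also have "(\<Sum>z\<in>Y - {x}. M w z) = (\<Sum>z\<in>Y - {x}. M w y)"
        by (intro sum.cong refl) (use that in blast)
      finally show ?thesis using x by (simp add: m_def)
    qed
    moreover have "M x z = M x y" "M v z = M v y" if "z \<in> Y" "z \<noteq> x" for z
      using BM_cong[OF M, of x z x y] BM_cong[OF M, of v z v y] pair[OF that] vpair[OF that] xy vy
      by auto
    ultimately show "(\<Sum>z\<in>Y. M x z) = M x x + m * M x y" "(\<Sum>z\<in>Y. M v z) = M v x + m * M v y"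
      by blast+
  qed
  define a b c d where abcd: "a = E 1 x x" "b = E 1 x y" "c = E 1 v x" "d = E 1 v y"
  have ab: "a + m * b = 0" and cd: "c + m * d = 0"
    using E1 sums[OF E_BM[OF D(1)]] mvec_charv[of "E 1" Y] by (auto simp: abcd Defs.zero_vec_def)
  have m: "m \<noteq> 0" "m \<noteq> 1" "m + 1 \<noteq> 0"
  proof -
    have "card Y - 1 \<noteq> 0" "card Y - 1 \<noteq> 1" using Y3 by auto
    then show "m \<noteq> 0" "m \<noteq> 1" unfolding m_def by (simp_all only: of_nat_eq_0_iff of_nat_eq_1_iff not_False_eq_True)
    have "m + 1 = of_nat (Suc (card Y - 1))" by (simp add: m_def)
    then show "m + 1 \<noteq> 0" by (simp only: of_nat_eq_0_iff)
  qed
  have ne_bd: "b \<noteq> d" and ne_cd: "c \<noteq> d" and ne_ab: "a \<noteq> b"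
    using E1_inj[of x y v y] E1_inj[of v x v y] E1_inj[of x x x y] xy vy xv dst_sym[of x v] D3 dst_0[of x x]
    by (auto simp: abcd)
  obtain p where p: "degree p = 2" "\<And>x y. E 2 x y = poly p (E 1 x y)" using E_poly[OF D(2)] by blast
  define \<alpha> \<beta> \<gamma> where coeffs: "\<alpha> = coeff p 2" "\<beta> = coeff p 1" "\<gamma> = coeff p 0"
  have \<alpha>: "\<alpha> \<noteq> 0" using p(1) unfolding coeffs by (metis leading_coeff_0_iff degree_0 zero_neq_numeral)
  have quad: "E 2 u w = \<alpha> * (E 1 u w * E 1 u w) + \<beta> * E 1 u w + \<gamma>" for u w
    unfolding p(2) poly_altdef p(1) coeffs by (simp add: numeral_2_eq_2 atMost_Suc)
  \<comment> \<open>With \<open>E 2\<close> annihilating \<open>charv Y\<close>, comparing the two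
    rows gives \<open>b * b = d * d\<close>. With equal columns instead,
    \<open>a + b = c + d\<close> leads to \<open>b = d\<close>, which is absurd since
    \<open>m\<close> is not 1.\<close>
  have "d = - b"
    using E2
  proof
    assume 0: "mvec (E 2) (charv Y) = zero_vec"
    have "E 2 x x + m * E 2 x y = 0" "E 2 v x + m * E 2 v y = 0"
      using 0 sums[OF E_BM[OF D(2)]] mvec_charv[of "E 2" Y] by (auto simp: Defs.zero_vec_def)
    then have 1: "\<alpha> * (a * a + m * (b * b)) + \<beta> * (a + m * b) + (1 + m) * \<gamma> = 0"
      and 2: "\<alpha> * (c * c + m * (d * d)) + \<beta> * (c + m * d) + (1 + m) * \<gamma> = 0"
      unfolding quad abcd by (auto simp: algebra_simps)
    have "\<alpha> * (a * a + m * (b * b)) = \<alpha> * (c * c + m * (d * d))"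
      using 1 2 unfolding ab cd by (simp add: eq_neg_iff_add_eq_0[symmetric])
    then have 3: "a * a + m * (b * b) = c * c + m * (d * d)" using \<alpha> by simp
    have "a = - (m * b)" "c = - (m * d)" using ab cd by (simp_all add: eq_neg_iff_add_eq_0)
    then have "m * (m + 1) * (b * b) = m * (m + 1) * (d * d)" using 3 by (simp add: algebra_simps)
    then have "b * b = d * d" using m by simp
    then show ?thesis using ne_bd by (metis square_eq_iff minus_minus)
  next
    assume "\<forall>y\<in>Y. \<forall>w. E 2 w x = E 2 w y"
    then have "E 2 x x = E 2 x y" "E 2 v x = E 2 v y" using y by auto
    then have "(a - b) * (\<alpha> * (a + b) + \<beta>) = 0" "(c - d) * (\<alpha> * (c + d) + \<beta>) = 0"
      unfolding quad abcd by (auto simp: algebra_simps)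
    then have "\<alpha> * (a + b) + \<beta> = 0" "\<alpha> * (c + d) + \<beta> = 0" using ne_ab ne_cd by auto
    then have "\<alpha> * (a + b) = \<alpha> * (c + d)" by (metis add_right_cancel)
    then have 3: "a + b = c + d" using \<alpha> by simp
    have "a = - (m * b)" "c = - (m * d)" using ab cd by (simp_all add: eq_neg_iff_add_eq_0)
    then have "(1 - m) * b = (1 - m) * d" using 3 by (simp add: algebra_simps)
    then have "b = d" using m by simp
    then show ?thesis using ne_bd by blast
  qed
  moreover have "a = - (m * b)" "c = - (m * d)" using ab cd by (simp_all add: eq_neg_iff_add_eq_0)
  ultimately have "c = - a" by simp
  then have neg: "E 1 x v = - E 1 x x" using E_sym[OF D(1), of v x] by (simp add: abcd)
  \<comment> \<open>Columns of \<open>E 1\<close> change sign along every edge, so points at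
    distance two have equal columns, against \<open>E1_inj\<close>.\<close>
  have col: "E 1 w p = - E 1 w q" if "dst p q = 1" for p q w
    using E_column[OF D(1), of "-1" p q w] E_cong[OF D(1), of p q x v] that xv neg
      E_diag_const[OF D(1), of p x] by simp
  obtain p q where pq: "dst p q = Suc 1" using dst_attained[of "Suc 1"] D3 by auto
  obtain r where r: "dst p r = 1" "dst r q = 1" using closer_neighbour[OF pq] by blast
  have "E 1 p p = E 1 p q" using col[OF r(1), of p] col[OF r(2), of p] by simp
  from E1_inj[OF this] show False using pq dst_0[of p p] by simp
qed

lemma small_delta_star_cases:
  assumes not_cycle: "\<not> is_cycle_graph (R 1)"
    and Y2: "1 < card Y" and YU: "Y \<noteq> UNIV"
    and line: "\<And>x. x \<in> Y \<Longrightarrow>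
        \<exists>c. \<forall>y. mvec (E (delta_star D E Y)) (charv Y) y = c * E (delta_star D E Y) y x"
  shows "(bipartite_graph (R 1) \<and> bipartite_half (R 1) Y)
       \<or> (antipodal_double_cover D R \<and> (\<exists>x y. Y = {x, y} \<and> (x, y) \<in> R D))"
proof -
  define \<delta> where "\<delta> = delta_star D E Y"
  have Y0: "Y \<noteq> {}" using Y2 by auto
  note props = delta_star_props[OF Y0 YU, folded \<delta>_def]
  have \<delta>: "1 \<le> \<delta>" "\<delta> \<le> D" using props by auto
  have one: "1 \<le> D" using D3 by simp
  obtain c where c: "\<And>x y. x \<in> Y \<Longrightarrow> mvec (E \<delta>) (charv Y) y = c x * E \<delta> y x"
    using line unfolding \<delta>_def[symmetric] by metis
  have c0: "c x \<noteq> 0" if "x \<in> Y" for x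
    using c[OF that] props(3) by (auto simp: Defs.zero_vec_def fun_eq_iff)
  \<comment> \<open>The vector is a multiple of both columns; evaluating it at \<open>x\<close> and
    at \<open>y\<close> and multiplying the two equations cancels the factors \<open>c x\<close> and
    \<open>c y\<close>.\<close>
  have sgn: "\<exists>s. (s = 1 \<or> s = -1) \<and> E \<delta> x y = s * E \<delta> x x" if xy: "x \<in> Y" "y \<in> Y" for x y
  proof -
    define e where "e = E \<delta> x x"
    have 1: "c x * e = c y * E \<delta> x y" using c[OF xy(1), of x] c[OF xy(2), of x] by (simp add: e_def)
    have 2: "c x * E \<delta> x y = c y * e"
      using c[OF xy(1), of y] c[OF xy(2), of y] E_sym[OF \<delta>(2), of y x] E_diag_const[OF \<delta>(2), of y x]
      by (simp add: e_def)
    have "(c x * e) * (c y * e) = (c y * E \<delta> x y) * (c x * E \<delta> x y)" unfolding 1 2 ..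
    then have "(c x * c y) * (e * e) = (c x * c y) * (E \<delta> x y * E \<delta> x y)" by (simp add: algebra_simps)
    then have "e * e = E \<delta> x y * E \<delta> x y" using c0 xy by simp
    then have "E \<delta> x y = e \<or> E \<delta> x y = - e" by (metis square_eq_iff)
    then show ?thesis unfolding e_def by (metis mult_1 mult_minus1)
  qed
  \<comment> \<open>For \<open>E 1\<close> the sign between distinct points of \<open>Y\<close> must
    be -1. A third point would repeat a column, and for two points the opposite columns add up to
    zero.\<close>
  have \<delta>1: "\<delta> \<noteq> 1"
  proof
    assume d1: "\<delta> = 1"
    have neg: "E 1 w x = - E 1 w y" if xy: "x \<in> Y" "y \<in> Y" "x \<noteq> y" for x y w
    proof -
      obtain s where s: "s = 1 \<or> s = -1" "E 1 x y = s * E 1 x x" using sgn[OF xy(1,2)] d1 by auto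
      have "s \<noteq> 1"
      proof
        assume "s = 1"
        then have "E 1 x y = E 1 x x" using s(2) by simp
        from E1_inj[OF this] show False using xy(3) by (metis dst_0)
      qed
      then have "s = -1" using s(1) by blast
      then show ?thesis using E_column[OF one _ s(2), of w] by simp
    qed
    obtain x y where xy: "x \<in> Y" "y \<in> Y" "x \<noteq> y"
      using Y2 card_le_Suc0_iff_eq[of Y] by auto
    have "z = y" if z: "z \<in> Y" "z \<noteq> x" for z
    proof -
      have "E 1 y z = E 1 y y" using neg[OF xy, of y] neg[OF xy(1) z(1), of y] z(2) by auto
      from E1_inj[OF this] show ?thesis by (metis dst_0)
    qed
    then have "Y = {x, y}" using xy by blast
    then have "mvec (E 1) (charv Y) w = 0" for w
      unfolding mvec_charv using xy neg[OF xy, of w] by simp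
    then show False using props(3) d1 by (auto simp: Defs.zero_vec_def fun_eq_iff)
  qed
  then have E1: "mvec (E 1) (charv Y) = zero_vec" using props(4)[of 1] \<delta> by simp
  show ?thesis
  proof (cases "\<exists>x\<in>Y. \<exists>y\<in>Y. x \<noteq> y \<and> dst x y < D")
    case True
    then obtain x y where xy: "x \<in> Y" "y \<in> Y" "x \<noteq> y" "dst x y < D" by blast
    obtain s where s: "s = 1 \<or> s = -1" "E \<delta> x y = s * E \<delta> x x" using sgn[OF xy(1,2)] by blast
    have "dst x y \<noteq> 0" using xy(3) by simp
    then have "1 \<le> dst x y" by linarith
    from distance_two_columns_eq[OF \<delta> refl this xy(4) s three_neighbours[OF not_cycle]]
    obtain u v where uv: "dst u v = 2" "\<And>w. E \<delta> w u = E \<delta> w v" by blast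
    have two: "E \<delta> w a = E \<delta> w b" if "dst a b = 2" for a b w
      by (rule columns_eq_transport[OF \<delta>(2) uv(2)]) (use that uv(1) in simp)
    have neg: "E \<delta> a b = - E \<delta> a a" if "dst a b = 1" for a b
      by (rule neighbour_value_neg[OF \<delta> two that])
    have \<delta>D: "\<delta> = D" using bipartite_idempotent(1)[OF \<delta>] neg by blast
    \<comment> \<open>With the index \<open>D\<close> minimal, only the components for
      \<open>E 0\<close> and \<open>E D\<close> survive, and the second changes sign along
      edges.\<close>
    have chi: "charv Y z = mvec (E 0) (charv Y) x + c x * E \<delta> z x" for z
    proof -
      have "charv Y z = (\<Sum>j\<le>D. mvec (E j) (charv Y) z)" by (rule sum_mvec_E[symmetric])
      also have "\<dots> = (\<Sum>j\<in>{0, D}. mvec (E j) (charv Y) z)"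
      proof (rule sum.mono_neutral_right)
        show "\<forall>i\<in>{..D} - {0, D}. mvec (E i) (charv Y) z = 0"
          using props(4) \<delta>D by (auto simp: Defs.zero_vec_def)
      qed auto
      also have "\<dots> = mvec (E 0) (charv Y) z + mvec (E D) (charv Y) z" using D3 by simp
      also have "mvec (E 0) (charv Y) z = mvec (E 0) (charv Y) x" by (simp add: mvec_charv E_0)
      finally show ?thesis using c[OF xy(1), of z] \<delta>D by simp
    qed
    have "a \<in> Y \<longleftrightarrow> b \<notin> Y" if "(a, b) \<in> R 1" for a b
    proof -
      have "dst a b = 1" using that R1_iff by blast
      then have "E \<delta> b x = - E \<delta> a x" using bipartite_idempotent(2)[OF \<delta>] neg by blast
      moreover have "E \<delta> a x \<noteq> 0" using bipartite_idempotent(3)[OF \<delta>] neg by blast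
      ultimately have "c x * E \<delta> a x \<noteq> c x * E \<delta> b x" using c0[OF xy(1)] by simp
      then have "charv Y a \<noteq> charv Y b" using chi[of a] chi[of b] by (metis add_left_cancel)
      then show ?thesis by (auto simp: charv_def split: if_splits)
    qed
    then have "bipartite_half (R 1) Y" by (auto simp: bipartite_half_def)
    then show ?thesis unfolding bipartite_graph_def bipartite_half_def by blast
  next
    case False
    have pair: "dst x y = D" if "x \<in> Y" "y \<in> Y" "x \<noteq> y" for x y
      using False that dst_le[of x y] by (metis le_neq_implies_less)
    obtain x y where xy: "x \<in> Y" "y \<in> Y" "x \<noteq> y"
      using Y2 card_le_Suc0_iff_eq[of Y] by auto
    show ?thesis
    proof (cases "card Y = 2")
      case True
      then have "Y = {x, y}" using xy by (metis card_2_iff doubleton_eq_iff insertE singletonD)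
      then have "E 1 x x + E 1 x y = 0"
        using E1 mvec_charv[of "E 1" Y x] xy(3) by (simp add: Defs.zero_vec_def)
      then have "E 1 x y = - E 1 x x" by (simp add: eq_neg_iff_add_eq_0 add.commute)
      then have "antipodal_double_cover D R" using antipodal_double_coverI pair[OF xy] by blast
      moreover have "(x, y) \<in> R D" using pair[OF xy] R_iff[of D x y] by simp
      ultimately show ?thesis using \<open>Y = {x, y}\<close> by blast
    next
      case False
      then have Y3: "3 \<le> card Y" using Y2 by linarith
      have "\<not> Y \<subseteq> {x, y}" using Y3 card_mono[of "{x, y}" Y] card_insert_le_m1[of 2 "{y}" x] by auto
      then obtain z where z: "z \<in> Y" "z \<noteq> x" "z \<noteq> y" by blast
      obtain s where s: "s = 1 \<or> s = -1" "E \<delta> x y = s * E \<delta> x x" using sgn[OF xy(1,2)] by blast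
      have col: "E \<delta> w a = s * E \<delta> w b" if "dst a b = D" for a b w
        using E_column[OF \<delta>(2) s(1), of a b w] E_cong[OF \<delta>(2), of a b x y] s(2) pair[OF xy] that
          E_diag_const[OF \<delta>(2), of a x] by simp
      \<comment> \<open>Three points pairwise at distance \<open>D\<close>: going from
        \<open>x\<close> to \<open>z\<close> through \<open>y\<close> compares \<open>s * s\<close>
        with \<open>s\<close>, which forces \<open>s = 1\<close>.\<close>
      have "E \<delta> x x = s * (s * E \<delta> x z)"
        using col[of x y x] col[of y z x] pair xy z by metis
      moreover have "E \<delta> x x = s * E \<delta> x z" using col[of x z x] pair xy z by metis
      ultimately have "s = 1" using s(1) E_diag_nonzero[OF \<delta>(2), of x] by auto
      then have col1: "E \<delta> w a = E \<delta> w b" if "dst a b = D" for a b w using col[OF that] by simp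
      obtain v where v: "dst x v = 1" using ex_at_dst[of 1 x] one by blast
      have vp: "Suc (dst v q) = D" if q: "q \<in> Y" "q \<noteq> x" for q
      proof -
        have qx: "dst q x = D" using pair[of q x] q xy by blast
        have "dst q v \<noteq> D"
        proof
          assume qv: "dst q v = D"
          have "E \<delta> w x = E \<delta> w v" for w using col1[OF qv, of w] col1[OF qx, of w] by simp
          from columns_eq_not_adjacent[OF \<delta> this] show False using v by simp
        qed
        then have "Suc (dst q v) = D"
          using neighbour_cases[OF qx v] dst_le[of q v] by linarith
        then show ?thesis by (simp add: dst_sym)
      qed
      \<comment> \<open>Either the minimal index is 2, and columns at distance \<open>D\<close>
        agree for \<open>E 2\<close>, or it is larger and \<open>E 2\<close> annihilates
        \<open>charv Y\<close>.\<close>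
      have "mvec (E 2) (charv Y) = zero_vec \<or> (\<forall>y\<in>Y. \<forall>w. E 2 w x = E 2 w y)"
      proof (cases "\<delta> = 2")
        case True
        then show ?thesis using col1 pair xy(1) by (metis)
      next
        case False
        then show ?thesis using props(4)[of 2] \<delta> \<delta>1 by simp
      qed
      then show ?thesis
        using no_large_antipodal_set[OF Y3 xy(1) _ v vp E1] pair xy(1) by blast
    qed
  qed
qed

end

theorem theorem6p3:
  fixes D t :: nat
    and R :: "nat \<Rightarrow> ('a::finite \<times> 'a) set"
    and E :: "nat \<Rightarrow> 'a cmat"
    and Y :: "'a set"
  assumes scheme: "sym_assoc_scheme D R"
    and D3: "D \<ge> 3"
    and idem: "prim_idempotents D R E"
    and metric: "metric_scheme D R"
    and cometric: "cometric_scheme D E"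
    and not_cycle: "\<not> is_cycle_graph (R 1)"
    and Y_size: "1 < card Y" "card Y < card (UNIV :: 'a set)"
    and t_le: "t \<le> D"
    and codesign: "\<forall>l\<le>D. \<forall>x\<in>Y. rel_codesign R x t (mvec (adjm (R l)) (charv Y))"
    and modules: "\<forall>x\<in>Y. \<forall>W. irred_Tmodule D R E x W \<and>
                    1 \<le> dual_endpoint D E W \<and> dual_endpoint D E W \<le> delta_star D E Y
                    \<longrightarrow> endpoint D R x W \<le> dual_endpoint D E W"
  shows "(bipartite_graph (R 1) \<and> bipartite_half (R 1) Y)
       \<or> (antipodal_double_cover D R \<and> (\<exists>x y. Y = {x, y} \<and> (x, y) \<in> R D))
       \<or> delta_star D E Y \<ge> t + 1"
proof (cases "delta_star D E Y \<le> t")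
  case True
  interpret pq_scheme D R E
    by (unfold_locales) (fact scheme D3 idem metric cometric)+
  have Y: "Y \<noteq> {}" "Y \<noteq> UNIV" using Y_size by auto
  have "\<exists>c. \<forall>y. mvec (E (delta_star D E Y)) (charv Y) y = c * E (delta_star D E Y) y x"
    if x: "x \<in> Y" for x
    by (rule projection_in_line[OF Y x True t_le]) (use codesign modules x in auto)
  from small_delta_star_cases[OF not_cycle Y_size(1) Y(2) this] show ?thesis by blast
next
  case False
  then show ?thesis by simp
qed

end
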